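(* Let $\{b_i\}_{i\ge1}$ be a sequence of self-adjoint variables in $(\mathcal{A},\varphi)$ with $\varphi(b_i)=0$, $\varphi(b_i^2)=1$, and $\sup_i|\varphi(b_i^m)|<\infty$ for each $m\in\mathbb{N}$. Set $a_n=b_1+\cdots+b_n$ for each $n\in\mathbb{N}$. Let $\{w_n\}$ be a sequence of positive integers increasing to infinity. Let $\{N_n\}$ be non-negative integer-valued random variables such that $N_n/w_n\to1$ in probability, and let $\{(N_n/w_n)^m\}_{n\ge1}$ be uniformly integrable for each $m\in\mathbb{N}$. Then, as $n\to\infty$, the following hold. (i) If $\{b_i\}$ are free, then $\frac{a_{N_n}}{\sqrt{w_n}}\stackrel{*}{\to}s$, a standard semi-circle variable. (ii) If $\{b_i\}$ are independent, then $\frac{a_{N_n}}{\sqrt{w_n}}\stackrel{*}{\to}z$, a standard Gaussian variable. (iii) If $\{b_i\}$ are half-independent, then $\frac{a_{N_n}}{\sqrt{w_n}}\stackrel{*}{\to}r_S$, a standard symmetrized Rayleigh variable.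
   Context: $(\mathcal{A},\varphi)$ is a non-commutative probability space (NCP), that is, a unital algebra $\mathcal{A}$ with unit $1_{\mathcal{A}}$ (carrying an involution $*$, so that self-adjoint means $a=a^*$) and a linear functional $\varphi:\mathcal{A}\to\mathbb{C}$ with $\varphi(1_{\mathcal{A}})=1$; moreover $\varphi$ is tracial: $\varphi(ab)=\varphi(ba)$ for all $a,b\in\mathcal{A}$. All the random variables $N_n$ have finite moments of all orders and are independent of $\mathcal{A}$; by convention $a_0=0$. The randomly indexed variable $a_{N_n}=\sum_{i\ge0}a_i\mathbb{I}_{\{N_n=i\}}$ lives in a larger non-commutative probability space with state $\tilde\varphi=\mathbb{E}\varphi$, so that for a polynomial $P$, $\tilde\varphi(P(a_{N_n}))=\sum_{i\ge0}\mathbb{P}\{N_n=i\}\varphi(P(a_i))$. For self-adjoint variables, $x_n\stackrel{*}{\to}x$ means that every moment of $x_n$ (computed in its state) converges to the corresponding moment of $x$. "Free" means freely independent: $\varphi(p_1(b_{i_1})\cdots p_k(b_{i_k}))=0$ whenever the $p_j$ are polynomials with $\varphi(p_j(b_{i_j}))=0$ for all $j$ and consecutive indices $i_j,i_{j+1}$ are distinct. "Independent" means the variables commute and $\varphi(b_{i_1}^{k_1}\cdots b_{i_r}^{k_r})=\prod_j\varphi(b_{i_j}^{k_j})$ for distinct $i_1,\dots,i_r$. Variables $\{b_i\}$ are half commuting if $b_ib_jb_k=b_kb_jb_i$ for all $i,j,k$ (so the $b_i^2$ commute). A monomial $b_{i_1}\cdots b_{i_k}$ is symmetric if each variable occurs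 in it equally often at odd and at even positions, and non-symmetric otherwise. The half-commuting variables $\{b_i\}$ are half-independent if $\{b_i^2\}$ are independent and $\varphi$ vanishes on every non-symmetric monomial in $\{b_i\}$. $s$, $z$, $r_S$ are self-adjoint variables whose probability measures (the unique probability measures on $\mathbb{R}$ with the same moments) are, respectively, that with density $\frac1{2\pi}\sqrt{4-x^2}$ on $[-2,2]$, the standard Gaussian law, and that with density $|x|e^{-x^2}$ on $\mathbb{R}$. *)

theory Defs
  imports
    "HOL-Probability.Probability"
    "HOL-Library.Function_Algebras"
    "HOL-Computational_Algebra.Polynomial"
begin

section \<open>Non-commutative probability spaces\<close>

text \<open>
  The unital complex \<open>*\<close>-algebra is a type of class \<^class>\<open>ring_1\<close> with an explicit complex
  scalar multiplication and an explicit involution. No positivity of the functional is required.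
\<close>

locale nc_prob_space = vector_space smul
  for smul :: "complex \<Rightarrow> 'a::ring_1 \<Rightarrow> 'a" +
  fixes star :: "'a \<Rightarrow> 'a" and \<phi> :: "'a \<Rightarrow> complex"
  assumes scale_mult_left: "smul c x * y = smul c (x * y)"
    and scale_mult_right: "x * smul c y = smul c (x * y)"
    and star_star: "star (star x) = x"
    and star_add: "star (x + y) = star x + star y"
    and star_mult: "star (x * y) = star y * star x"
    and star_scale: "star (smul c x) = smul (cnj c) (star x)"
    and functional_linear: "Vector_Spaces.linear smul (*) \<phi>"
    and functional_one: "\<phi> 1 = 1"

locale tracial_nc_prob_space = nc_prob_space +
  assumes tracial: "\<phi> (x * y) = \<phi> (y * x)"

definition self_adjoint :: "('a \<Rightarrow> 'a) \<Rightarrow> 'a \<Rightarrow> bool" where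
  "self_adjoint star x \<longleftrightarrow> star x = x"

definition alg_poly :: "(complex \<Rightarrow> 'a::ring_1 \<Rightarrow> 'a) \<Rightarrow> complex poly \<Rightarrow> 'a \<Rightarrow> 'a" where
  "alg_poly smul p x = (\<Sum>k\<le>degree p. smul (coeff p k) (x ^ k))"

section \<open>Notions of independence\<close>

text \<open>
  A product \<open>p\<^sub>1(b i\<^sub>1) \<cdots> p\<^sub>k(b i\<^sub>k)\<close>, \<open>k \<ge> 1\<close>, is encoded by the list of the pairs \<open>(i\<^sub>j, p\<^sub>j)\<close>.
  The variables are meant to be self-adjoint, so no adjoints occur in the polynomials.
\<close>

definition free_family ::
  "(complex \<Rightarrow> 'a::ring_1 \<Rightarrow> 'a) \<Rightarrow> ('a \<Rightarrow> complex) \<Rightarrow> 'i set \<Rightarrow> ('i \<Rightarrow> 'a) \<Rightarrow> bool" where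
  "free_family smul \<phi> I b \<longleftrightarrow>
     (\<forall>ips :: ('i \<times> complex poly) list.
        ips \<noteq> [] \<longrightarrow>
        (\<forall>(i, p) \<in> set ips. i \<in> I \<and> \<phi> (alg_poly smul p (b i)) = 0) \<longrightarrow>
        successively (\<noteq>) (map fst ips) \<longrightarrow>
        \<phi> (prod_list (map (\<lambda>(i, p). alg_poly smul p (b i)) ips)) = 0)"

definition independent_family ::
  "('a::ring_1 \<Rightarrow> complex) \<Rightarrow> 'i set \<Rightarrow> ('i \<Rightarrow> 'a) \<Rightarrow> bool" where
  "independent_family \<phi> I b \<longleftrightarrow>
     (\<forall>i\<in>I. \<forall>j\<in>I. b i * b j = b j * b i) \<and>
     (\<forall>(js :: 'i list) (k :: 'i \<Rightarrow> nat). distinct js \<longrightarrow> set js \<subseteq> I \<longrightarrow>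
        \<phi> (prod_list (map (\<lambda>i. b i ^ k i) js)) = (\<Prod>i\<in>set js. \<phi> (b i ^ k i)))"

definition half_commuting :: "'i set \<Rightarrow> ('i \<Rightarrow> 'a::ring_1) \<Rightarrow> bool" where
  "half_commuting I b \<longleftrightarrow>
     (\<forall>i\<in>I. \<forall>j\<in>I. \<forall>k\<in>I. b i * b j * b k = b k * b j * b i)"

text \<open>
  The monomial \<open>b i\<^sub>1 \<cdots> b i\<^sub>k\<close> is encoded by the list of its indices. List positions are counted
  from 0, which exchanges odd and even positions and so does not affect the condition.
\<close>

definition symmetric_monomial :: "'i list \<Rightarrow> bool" where
  "symmetric_monomial js \<longleftrightarrow>
     (\<forall>i. card {p. p < length js \<and> odd p \<and> js ! p = i} =
          card {p. p < length js \<and> even p \<and> js ! p = i})"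

definition half_independent_family ::
  "('a::ring_1 \<Rightarrow> complex) \<Rightarrow> 'i set \<Rightarrow> ('i \<Rightarrow> 'a) \<Rightarrow> bool" where
  "half_independent_family \<phi> I b \<longleftrightarrow>
     half_commuting I b \<and>
     independent_family \<phi> I (\<lambda>i. b i ^ 2) \<and>
     (\<forall>js. set js \<subseteq> I \<longrightarrow> \<not> symmetric_monomial js \<longrightarrow> \<phi> (prod_list (map b js)) = 0)"

section \<open>Laws of self-adjoint variables\<close>

definition has_moments :: "('a::ring_1 \<Rightarrow> complex) \<Rightarrow> 'a \<Rightarrow> real measure \<Rightarrow> bool" where
  "has_moments \<phi> x \<mu> \<longleftrightarrow>
     prob_space \<mu> \<and> sets \<mu> = sets borel \<and>
     (\<forall>k. integrable \<mu> (\<lambda>t. t ^ k) \<and> \<phi> (x ^ k) = complex_of_real (\<integral>t. t ^ k \<partial>\<mu>))"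

definition has_law ::
  "('a::ring_1 \<Rightarrow> 'a) \<Rightarrow> ('a \<Rightarrow> complex) \<Rightarrow> 'a \<Rightarrow> real measure \<Rightarrow> bool" where
  "has_law star \<phi> x \<mu> \<longleftrightarrow>
     self_adjoint star x \<and> has_moments \<phi> x \<mu> \<and> (\<forall>\<nu>. has_moments \<phi> x \<nu> \<longrightarrow> \<nu> = \<mu>)"

definition semicircle_law :: "real measure" where
  "semicircle_law =
     density lborel (\<lambda>x. ennreal (indicator {-2..2} x * (1 / (2 * pi) * sqrt (4 - x\<^sup>2))))"

definition symmetrized_rayleigh_law :: "real measure" where
  "symmetrized_rayleigh_law = density lborel (\<lambda>x. ennreal (\<bar>x\<bar> * exp (- x\<^sup>2)))"

section \<open>Random elements of a non-commutative probability space\<close>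

text \<open>
  The larger algebra consists of \<open>'a\<close>-valued functions on the sample space of a classical
  probability space \<open>M\<close>, with the pointwise operations of
  \<^theory>\<open>HOL-Library.Function_Algebras\<close>. Non-commutative variables are the constant functions and
  classical ones are the scalar-valued functions; the functional \<open>E \<phi>\<close> makes the two independent.
  It is only meaningful on \<open>rand_domain M \<phi>\<close>.
\<close>

definition rand_domain :: "'w measure \<Rightarrow> ('a \<Rightarrow> complex) \<Rightarrow> ('w \<Rightarrow> 'a) set" where
  "rand_domain M \<phi> = {X. integrable M (\<lambda>\<omega>. \<phi> (X \<omega>))}"

definition rand_state :: "'w measure \<Rightarrow> ('a \<Rightarrow> complex) \<Rightarrow> ('w \<Rightarrow> 'a) \<Rightarrow> complex" where
  "rand_state M \<phi> X = (\<integral>\<omega>. \<phi> (X \<omega>) \<partial>M)"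

definition rand_scale :: "(complex \<Rightarrow> 'a \<Rightarrow> 'a) \<Rightarrow> complex \<Rightarrow> ('w \<Rightarrow> 'a) \<Rightarrow> 'w \<Rightarrow> 'a" where
  "rand_scale smul c X = (\<lambda>\<omega>. smul c (X \<omega>))"

definition rand_indexed :: "(nat \<Rightarrow> 'a) \<Rightarrow> ('w \<Rightarrow> nat) \<Rightarrow> 'w \<Rightarrow> 'a" where
  "rand_indexed a K = (\<lambda>\<omega>. a (K \<omega>))"

lemma power_fun_apply: "(X ^ k) \<omega> = X \<omega> ^ k"
  for X :: "'w \<Rightarrow> 'a::ring_1"
  by (induction k) auto

text \<open>The integral agrees with the series \<open>\<Sum>i. P(K = i) \<phi>(p(a i))\<close>.\<close>

lemma rand_state_poly_rand_indexed:
  fixes smul :: "complex \<Rightarrow> 'a::ring_1 \<Rightarrow> 'a" and M :: "'w measure"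
    and \<phi> :: "'a \<Rightarrow> complex" and a :: "nat \<Rightarrow> 'a"
  assumes "prob_space M" and [measurable]: "K \<in> measurable M (count_space UNIV)"
    and dom: "alg_poly (rand_scale smul) p (rand_indexed a K) \<in> rand_domain M \<phi>"
  shows "(\<lambda>i. measure M {\<omega> \<in> space M. K \<omega> = i} * \<phi> (alg_poly smul p (a i))) sums
           rand_state M \<phi> (alg_poly (rand_scale smul) p (rand_indexed a K))"
proof -
  interpret prob_space M by fact
  define f where "f i = \<phi> (alg_poly smul p (a i))" for i
  have sum_apply: "(\<Sum>k\<in>A. g k) \<omega> = (\<Sum>k\<in>A. g k \<omega>)"
    for A :: "nat set" and g :: "nat \<Rightarrow> 'w \<Rightarrow> 'a" and \<omega>
    by (induction A rule: infinite_finite_induct) auto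
  have eq: "\<phi> (alg_poly (rand_scale smul) p (rand_indexed a K) \<omega>) = f (K \<omega>)" for \<omega>
    by (simp add: f_def alg_poly_def sum_apply rand_scale_def rand_indexed_def power_fun_apply)
  let ?D = "distr M (count_space UNIV) K"
  have D: "?D = density (count_space UNIV) (\<lambda>i. ennreal (measure M {\<omega> \<in> space M. K \<omega> = i}))"
    (is "_ = ?R")
  proof (rule measure_eqI_countable[where A = UNIV])
    fix i :: nat
    have "K -` {i} \<inter> space M = {\<omega> \<in> space M. K \<omega> = i}" by auto
    then show "emeasure ?D {i} = emeasure ?R {i}"
      by (simp add: emeasure_distr emeasure_density emeasure_eq_measure
          nn_integral_count_space_indicator[symmetric] nn_integral_count_space_finite)
  qed auto
  have "integrable ?D f"
    using dom by (simp add: rand_domain_def eq integrable_distr_eq)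
  then have int: "integrable (count_space UNIV) (\<lambda>i. measure M {\<omega> \<in> space M. K \<omega> = i} *\<^sub>R f i)"
    unfolding D by (subst (asm) integrable_density) auto
  have "rand_state M \<phi> (alg_poly (rand_scale smul) p (rand_indexed a K)) = (\<integral>i. f i \<partial>?D)"
    by (simp add: rand_state_def eq integral_distr)
  also have "\<dots> = (\<integral>i. measure M {\<omega> \<in> space M. K \<omega> = i} *\<^sub>R f i \<partial>count_space UNIV)"
    unfolding D by (subst integral_density) auto
  finally show ?thesis
    using sums_integral_count_space_nat[OF int] by (simp add: f_def scaleR_conv_of_real)
qed

section \<open>Modes of convergence\<close>

text \<open>
  Convergence of all moments of \<open>x n\<close>, \<open>n \<ge> 1\<close>, for a functional \<open>\<psi>\<close> defined on \<open>D\<close>, including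
  the existence of these moments.
\<close>

definition star_converges ::
  "'b::ring_1 set \<Rightarrow> ('b \<Rightarrow> complex) \<Rightarrow> (nat \<Rightarrow> 'b) \<Rightarrow> ('c::ring_1 \<Rightarrow> complex) \<Rightarrow> 'c \<Rightarrow> bool" where
  "star_converges D \<psi> x \<tau> y \<longleftrightarrow>
     (\<forall>n\<ge>1. \<forall>k. x n ^ k \<in> D) \<and>
     (\<forall>k. (\<lambda>n. \<psi> (x n ^ k)) \<longlonglongrightarrow> \<tau> (y ^ k))"

definition tendsto_in_prob_const :: "'w measure \<Rightarrow> (nat \<Rightarrow> 'w \<Rightarrow> real) \<Rightarrow> real \<Rightarrow> bool" where
  "tendsto_in_prob_const M X c \<longleftrightarrow>
     (\<forall>\<epsilon>>0. (\<lambda>n. measure M {\<omega> \<in> space M. \<bar>X n \<omega> - c\<bar> > \<epsilon>}) \<longlonglongrightarrow> 0)"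

definition uniformly_integrable ::
  "'w measure \<Rightarrow> 'i set \<Rightarrow> ('i \<Rightarrow> 'w \<Rightarrow> real) \<Rightarrow> bool" where
  "uniformly_integrable M I X \<longleftrightarrow>
     (\<forall>i\<in>I. integrable M (X i)) \<and>
     (\<forall>\<epsilon>>0. \<exists>K. \<forall>i\<in>I. (\<integral>\<omega>. \<bar>X i \<omega>\<bar> * indicator {\<omega>. \<bar>X i \<omega>\<bar> > K} \<omega> \<partial>M) < \<epsilon>)"

end

theory Submission
  imports Defs "HOL-Real_Asymp.Real_Asymp"
begin

text \<open>
  Put \<open>F\<^sub>k(m) = \<phi>(a\<^sub>m\<^sup>k) / m\<^bsup>k/2\<^esup>\<close>. Expanding \<open>(a\<^sub>m + b\<^sub>m\<^sub>+\<^sub>1)\<^sup>k\<close>, the words with exactly one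
  \<open>b\<^sub>m\<^sub>+\<^sub>1\<close> have vanishing expectation, those with exactly two have an expectation given by lower moments
  of \<open>a\<^sub>m\<close>, in a way that depends on the notion of independence, and those with three or more are of
  lower order. So the increments of \<open>\<phi>(a\<^sub>m\<^sup>k)\<close> are asymptotic to a multiple of \<open>m\<^bsup>k/2-1\<^esup>\<close>, and by
  induction on \<open>k\<close> and summation \<open>F\<^sub>k(m)\<close> converges to a limit \<open>\<mu>\<^sub>k\<close> that satisfies a recurrence. The
  moments of the three laws satisfy these recurrences by integration by parts; for the semicircle
  law the two-term recurrence so obtained implies the Catalan convolution.

  Since \<open>F\<^sub>k\<close> is bounded and convergent, the expectation of \<open>F\<^sub>k(N\<^sub>n) (N\<^sub>n/w\<^sub>n)\<^bsup>k/2\<^esup>\<close> has the same limit, as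
  \<open>N\<^sub>n/w\<^sub>n\<close> tends to 1 in probability and its powers are uniformly integrable.
\<close>

section \<open>Sequences with small increments and random indices\<close>

text \<open>Positivity of the functional is not assumed, so mixed moments cannot be estimated by
  Cauchy-Schwarz or Hoelder; they must be bounded through the independence relations alone,
  uniformly in m. Working with increments reduces this to words in only two letters, a_m and
  b_{m+1}. A word of length k with at least two letters b_{m+1} contains at most k - 2 letters a_m,
  so the induction hypothesis covers every moment of a_m that is needed, and each further b_{m+1}
  gains a factor m^{-1/2}. The price is that each notion of independence has to pass from the
  sequence to the pair (a_m, b_{m+1}): for freeness this is associativity, for half-independence it
  is linearity of the half-commutation relation in each argument.

  The recurrences have a common form: with k = n + 2, the words a^i b a^j b a^l with given j number
  n + 1 - j, and the factor k/2 on the other side comes from the growth of m^{k/2}. Only the value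
  of such a word differs: the product of the moments of orders n - j and j, the moment of order n,
  or the latter for even j only.\<close>

lemma sqrt_power_diff_asymp:
  assumes "k \<ge> 2"
  shows "(\<lambda>m. (sqrt (real (Suc m)) ^ k - sqrt (real m) ^ k) / sqrt (real m) ^ (k - 2))
           \<longlonglongrightarrow> real k / 2"
proof -
  \<comment> \<open>For the two roots r and s with q = s / r, the relation r^2 (q - 1) (q + 1) = 1
    turns r^2 (q^k - 1) into a geometric sum over q + 1; odd and even \<open>k\<close> are thus
    treated alike.\<close>
  define q where "q m = sqrt (real (Suc m)) / sqrt (real m)" for m
  have "q \<longlonglongrightarrow> 1"
    unfolding q_def by real_asymp
  then have "(\<lambda>m. (\<Sum>i<k. q m ^ i) / (q m + 1)) \<longlonglongrightarrow> (\<Sum>i<k. 1 ^ i) / (1 + 1)"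
    by (intro tendsto_intros) auto
  moreover have "eventually (\<lambda>m. (\<Sum>i<k. q m ^ i) / (q m + 1) =
      (sqrt (real (Suc m)) ^ k - sqrt (real m) ^ k) / sqrt (real m) ^ (k - 2)) sequentially"
    using eventually_gt_at_top[of 0]
  proof eventually_elim
    case (elim m)
    define r s where "r = sqrt (real m)" and "s = sqrt (real (Suc m))"
    have r: "r > 0" and s: "s > 0" and sq: "s\<^sup>2 - r\<^sup>2 = 1"
      using elim by (auto simp: r_def s_def)
    have q: "q m = s / r" by (simp add: q_def r_def s_def)
    have pos: "s / r + 1 > 0" using r s by (simp add: add_pos_pos)
    have "r\<^sup>2 * ((s / r - 1) * (s / r + 1)) = 1"
      using r sq by (simp add: field_simps power2_eq_square)
    then have "r\<^sup>2 * ((s / r) ^ k - 1) * (s / r + 1) = (\<Sum>i<k. (s / r) ^ i)"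
      unfolding power_diff_1_eq by (metis (no_types, lifting) mult.assoc mult.commute mult.left_neutral)
    then have "(\<Sum>i<k. (s / r) ^ i) / (s / r + 1) = r\<^sup>2 * ((s / r) ^ k - 1)"
      using pos by (metis nonzero_eq_divide_eq less_irrefl)
    also have "\<dots> = r\<^sup>2 * (s ^ k - r ^ k) / r ^ k"
      using r by (simp add: field_simps)
    also have "\<dots> = (s ^ k - r ^ k) / r ^ (k - 2)"
      using r assms by (simp add: power_diff)
    finally show ?case
      by (simp add: q r_def s_def)
  qed
  ultimately show ?thesis
    by (simp add: tendsto_cong)
qed

text \<open>The null case of Stolz-Cesaro: at most m increments, with bounds \<epsilon> m^{k/2-1}
  that increase in m, add up to at most \<epsilon> m^{k/2}, and the starting value disappears on
  division.\<close>

lemma small_increments: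
  fixes e :: "nat \<Rightarrow> complex"
  assumes k: "k \<ge> 2"
    and lim: "(\<lambda>m. (e (Suc m) - e m) / of_real (sqrt (real m) ^ (k - 2))) \<longlonglongrightarrow> 0"
  shows "(\<lambda>m. e m / of_real (sqrt (real m) ^ k)) \<longlonglongrightarrow> 0"
proof (rule LIMSEQ_I)
  fix r :: real assume "r > 0"
  define \<epsilon> where "\<epsilon> = r / 2"
  have "\<epsilon> > 0" using \<open>r > 0\<close> by (simp add: \<epsilon>_def)
  have split: "sqrt (real m) ^ k = real m * sqrt (real m) ^ (k - 2)" for m
    using k by (metis le_add_diff_inverse power_add real_sqrt_pow2 of_nat_0_le_iff)
  obtain M0 where M0: "\<And>m. m \<ge> M0 \<Longrightarrow>
      cmod ((e (Suc m) - e m) / of_real (sqrt (real m) ^ (k - 2))) < \<epsilon>"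
    using LIMSEQ_D[OF lim \<open>\<epsilon> > 0\<close>] by auto
  define M where "M = max 1 M0"
  have incr: "cmod (e (Suc m) - e m) \<le> \<epsilon> * sqrt (real m) ^ (k - 2)" if "m \<ge> M" for m
    using M0[of m] that by (auto simp: M_def norm_divide norm_power field_simps)
  have bound: "cmod (e m) \<le> cmod (e M) + \<epsilon> * sqrt (real m) ^ k" if "m \<ge> M" for m
    using that
  proof (induction m rule: dec_induct)
    case base
    then show ?case using \<open>\<epsilon> > 0\<close> by simp
  next
    case (step m)
    have "cmod (e (Suc m)) \<le> cmod (e m) + cmod (e (Suc m) - e m)"
      by (metis add.commute diff_add_cancel norm_triangle_ineq)
    also have "\<dots> \<le> cmod (e M) + \<epsilon> * (real (Suc m) * sqrt (real m) ^ (k - 2))"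
      using step incr[of m] by (simp add: split algebra_simps)
    also have "\<dots> \<le> cmod (e M) + \<epsilon> * (real (Suc m) * sqrt (real (Suc m)) ^ (k - 2))"
      using \<open>\<epsilon> > 0\<close> by (intro add_left_mono mult_left_mono power_mono) auto
    finally show ?case by (simp only: split)
  qed
  have "(\<lambda>m. cmod (e M) * (1 / sqrt (real m)) ^ k) \<longlonglongrightarrow> cmod (e M) * 0 ^ k"
    by (intro tendsto_intros) real_asymp
  then have "(\<lambda>m. cmod (e M) * (1 / sqrt (real m)) ^ k) \<longlonglongrightarrow> 0"
    using k by (simp add: power_0_left)
  then have "eventually (\<lambda>m. cmod (e M) * (1 / sqrt (real m)) ^ k < \<epsilon>) sequentially"
    using \<open>\<epsilon> > 0\<close> by (rule order_tendstoD)
  then obtain M1 where M1: "\<And>m. m \<ge> M1 \<Longrightarrow> cmod (e M) * (1 / sqrt (real m)) ^ k < \<epsilon>"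
    by (auto simp: eventually_sequentially)
  show "\<exists>no. \<forall>m\<ge>no. cmod (e m / of_real (sqrt (real m) ^ k) - 0) < r"
  proof (intro exI allI impI)
    fix m assume m: "m \<ge> max M M1"
    then have pos: "sqrt (real m) ^ k \<noteq> 0" "sqrt (real m) ^ k > 0" by (simp_all add: M_def)
    have "cmod (e m / of_real (sqrt (real m) ^ k)) = cmod (e m) / sqrt (real m) ^ k"
      using pos by (simp add: norm_divide norm_power)
    also have "\<dots> \<le> (cmod (e M) + \<epsilon> * sqrt (real m) ^ k) / sqrt (real m) ^ k"
      using bound[of m] m pos by (intro divide_right_mono) auto
    also have "\<dots> = cmod (e M) * (1 / sqrt (real m)) ^ k + \<epsilon>"
      using pos(1) by (simp only: power_divide add_divide_distrib) simp
    also have "\<dots> < r"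
      using M1[of m] m by (simp add: \<epsilon>_def)
    finally show "cmod (e m / of_real (sqrt (real m) ^ k) - 0) < r" by simp
  qed
qed

text \<open>Subtracting d m^{k/2} leaves the null case, since this power itself has increments
  asymptotic to d (k/2) m^{k/2-1}.\<close>

lemma tendsto_of_increments:
  fixes h :: "nat \<Rightarrow> complex"
  assumes k: "k \<ge> 2"
    and lim: "(\<lambda>m. (h (Suc m) - h m) / of_real (sqrt (real m) ^ (k - 2))) \<longlonglongrightarrow> of_nat k / 2 * d"
  shows "(\<lambda>m. h m / of_real (sqrt (real m) ^ k)) \<longlonglongrightarrow> d"
proof -
  define e where "e m = h m - d * of_real (sqrt (real m) ^ k)" for m
  have "(\<lambda>m. (h (Suc m) - h m) / of_real (sqrt (real m) ^ (k - 2)) - d * of_real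
      ((sqrt (real (Suc m)) ^ k - sqrt (real m) ^ k) / sqrt (real m) ^ (k - 2)))
      \<longlonglongrightarrow> of_nat k / 2 * d - d * of_real (real k / 2)"
    by (intro tendsto_intros lim sqrt_power_diff_asymp k)
  then have "(\<lambda>m. (e (Suc m) - e m) / of_real (sqrt (real m) ^ (k - 2))) \<longlonglongrightarrow> 0"
    by (simp add: e_def algebra_simps diff_divide_distrib add_divide_distrib)
  from tendsto_add[OF small_increments[OF k this] tendsto_const[of d]]
  have "(\<lambda>m. e m / of_real (sqrt (real m) ^ k) + d) \<longlonglongrightarrow> d" by simp
  moreover have "eventually (\<lambda>m. e m / of_real (sqrt (real m) ^ k) + d =
      h m / of_real (sqrt (real m) ^ k)) sequentially"
    using eventually_gt_at_top[of 0]
    by eventually_elim (simp add: e_def field_simps)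
  ultimately show ?thesis by (simp add: tendsto_cong)
qed

section \<open>Sequences evaluated at a random index\<close>

text \<open>For m = 0 and k > 0 the quotient is 0 by the convention on division and says nothing
  about \<open>f 0\<close>, hence the hypothesis \<open>zero\<close>.\<close>

lemma normalized_sequence_bounded:
  fixes f :: "nat \<Rightarrow> complex"
  assumes lim: "(\<lambda>m. f m / of_real (sqrt (real m) ^ k)) \<longlonglongrightarrow> c"
    and zero: "k > 0 \<Longrightarrow> f 0 = 0"
  obtains C where "C > 0" "\<And>m. cmod (f m) \<le> C * sqrt (real m) ^ k"
proof -
  obtain C where C: "C > 0" "\<And>m. norm (f m / of_real (sqrt (real m) ^ k)) \<le> C"
    using convergent_imp_Bseq[of "\<lambda>m. f m / of_real (sqrt (real m) ^ k)"] lim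
    by (auto simp: Bseq_def convergent_def)
  have "cmod (f m) \<le> C * sqrt (real m) ^ k" for m
  proof (cases "m = 0 \<and> k > 0")
    case True
    then show ?thesis using zero C(1) by simp
  next
    case False
    then have "sqrt (real m) ^ k > 0" by (cases "k = 0") auto
    then show ?thesis
      using C(2)[of m] by (simp add: norm_divide norm_power pos_divide_le_eq)
  qed
  then show thesis using C(1) that by blast
qed

text \<open>Moments of the index are controlled for integral exponents, while the normalization
  involves half-integral ones.\<close>

lemma sqrt_power_le:
  assumes "y \<ge> 0"
  shows "sqrt y ^ k \<le> 1 + y ^ k"
proof (cases "y \<le> 1")
  case True
  then have "sqrt y ^ k \<le> 1" using assms by (intro power_le_one) auto
  then show ?thesis using assms by (simp add: add_increasing2)
next
  case False
  then have "sqrt y \<le> y" using assms by (intro real_le_lsqrt) (auto simp: power2_eq_square)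
  then have "sqrt y ^ k \<le> y ^ k" using assms by (intro power_mono) auto
  then show ?thesis by simp
qed

lemma random_index_integrable:
  fixes f :: "nat \<Rightarrow> complex"
  assumes "prob_space M" and K[measurable]: "K \<in> measurable M (count_space UNIV)"
    and int: "integrable M (\<lambda>\<omega>. real (K \<omega>) ^ k)"
    and lim: "(\<lambda>m. f m / of_real (sqrt (real m) ^ k)) \<longlonglongrightarrow> c"
    and zero: "k > 0 \<Longrightarrow> f 0 = 0"
  shows "integrable M (\<lambda>\<omega>. f (K \<omega>))"
proof -
  interpret prob_space M by fact
  obtain C where C: "C > 0" "\<And>m. cmod (f m) \<le> C * sqrt (real m) ^ k"
    using normalized_sequence_bounded[OF lim zero] by blast
  have "cmod (f m) \<le> norm (C * (1 + real m ^ k))" for m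
  proof -
    have "cmod (f m) \<le> C * sqrt (real m) ^ k" by (rule C(2))
    also have "\<dots> \<le> C * (1 + real m ^ k)"
      using C(1) by (intro mult_left_mono sqrt_power_le) auto
    finally show ?thesis by simp
  qed
  then show ?thesis
    using int by - (rule Bochner_Integration.integrable_bound[where f = "\<lambda>\<omega>. C * (1 + real (K \<omega>) ^ k)"],
      simp_all add: AE_I2)
qed

text \<open>Since f(m) / v^{k/2} = F(m) (m/v)^{k/2}, this is a joint limit for m to infinity and m/v
  to 1. With \<open>\<delta> \<le> 1 / 2\<close>, a ratio m/v near 1 forces m to be at least v/2,
  hence large together with v.\<close>

lemma normalized_sequence_near:
  fixes f :: "nat \<Rightarrow> complex"
  assumes lim: "(\<lambda>m. f m / of_real (sqrt (real m) ^ k)) \<longlonglongrightarrow> c" and "\<epsilon> > 0"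
  obtains \<delta> L where "0 < \<delta>" "\<delta> \<le> 1 / 2"
    "\<And>m v. m \<ge> L \<Longrightarrow> v > 0 \<Longrightarrow> \<bar>real m / real v - 1\<bar> \<le> \<delta> \<Longrightarrow>
       cmod (f m / of_real (sqrt (real v) ^ k) - c) \<le> \<epsilon>"
proof -
  define F where "F m = f m / of_real (sqrt (real m) ^ k)" for m
  have "((\<lambda>p. F (fst p) * of_real (sqrt (snd p) ^ k)) \<longlongrightarrow> c * of_real (sqrt 1 ^ k))
      (sequentially \<times>\<^sub>F nhds (1::real))"
  proof (intro tendsto_intros)
    show "((\<lambda>p. F (fst p)) \<longlongrightarrow> c) (sequentially \<times>\<^sub>F nhds (1::real))"
      using lim filterlim_fst unfolding F_def[symmetric] by (rule filterlim_compose)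
    show "((\<lambda>p. snd p) \<longlongrightarrow> 1) (sequentially \<times>\<^sub>F nhds (1::real))"
      by (rule filterlim_snd)
  qed
  then have "eventually (\<lambda>p. dist (F (fst p) * of_real (sqrt (snd p) ^ k)) c < \<epsilon>)
      (sequentially \<times>\<^sub>F nhds (1::real))"
    using \<open>\<epsilon> > 0\<close> by (auto dest: tendstoD)
  then obtain P Q where P: "eventually P sequentially" and Q: "eventually Q (nhds (1::real))"
    and near: "\<And>m y. P m \<Longrightarrow> Q y \<Longrightarrow> dist (F m * of_real (sqrt y ^ k)) c < \<epsilon>"
    by (auto simp: eventually_prod_filter)
  obtain L where L: "\<And>m. m \<ge> L \<Longrightarrow> P m"
    using P by (auto simp: eventually_sequentially)
  obtain d where d: "d > 0" "\<And>y. dist y 1 < d \<Longrightarrow> Q y"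
    using Q by (auto simp: eventually_nhds_metric)
  show thesis
  proof
    \<comment> \<open>Halving \<open>d\<close> makes a non-strict bound strict;
      \<open>max 1 L\<close> below excludes the division by zero in \<open>F 0\<close>.\<close>
    show "0 < min (1 / 2) (d / 2)" "min (1 / 2) (d / 2) \<le> 1 / 2" using d by auto
    fix m v :: nat
    assume m: "m \<ge> max 1 L" and v: "v > 0" and *: "\<bar>real m / real v - 1\<bar> \<le> min (1 / 2) (d / 2)"
    have "dist (F m * of_real (sqrt (real m / real v) ^ k)) c < \<epsilon>"
      using m * d by (intro near L d(2)) (auto simp: dist_real_def)
    moreover have "F m * of_real (sqrt (real m / real v) ^ k) = f m / of_real (sqrt (real v) ^ k)"
      using m v by (simp add: F_def real_sqrt_divide power_divide)
    ultimately show "cmod (f m / of_real (sqrt (real v) ^ k) - c) \<le> \<epsilon>"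
      by (simp add: dist_norm)
  qed
qed

text \<open>Off the event \<open>A n\<close> that the ratio deviates from 1 by more than \<delta>,
  the integrand is within \<epsilon> of \<open>c\<close>. On it, the integrand is at most C (1 +
  Y^k), where Y^k is cut at a level \<open>K\<close> from uniform integrability: the part below is
  charged to the probability of \<open>A n\<close>, the part above to the tail integral.\<close>

lemma random_index_limit:
  fixes f :: "nat \<Rightarrow> complex" and M :: "'w measure"
  assumes "prob_space M"
    and w: "\<And>n. n \<ge> 1 \<Longrightarrow> w n > 0" "filterlim w at_top sequentially"
    and N: "\<And>n. n \<ge> 1 \<Longrightarrow> N n \<in> measurable M (count_space UNIV)"
    and conv: "tendsto_in_prob_const M (\<lambda>n \<omega>. real (N n \<omega>) / real (w n)) 1"
    and ui: "uniformly_integrable M {1..} (\<lambda>n \<omega>. (real (N n \<omega>) / real (w n)) ^ k)"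
    and lim: "(\<lambda>m. f m / of_real (sqrt (real m) ^ k)) \<longlonglongrightarrow> c"
    and zero: "k > 0 \<Longrightarrow> f 0 = 0"
  shows "(\<lambda>n. \<integral>\<omega>. f (N n \<omega>) / of_real (sqrt (real (w n)) ^ k) \<partial>M) \<longlonglongrightarrow> c"
proof (rule LIMSEQ_I)
  interpret prob_space M by fact
  fix r :: real assume "r > 0"
  obtain C where C: "C > 0" "\<And>m. cmod (f m) \<le> C * sqrt (real m) ^ k"
    using normalized_sequence_bounded[OF lim zero] by blast
  \<comment> \<open>The three contributions will be \<epsilon>, \<epsilon> and
    \<open>C * \<epsilon>\<close>.\<close>
  define \<epsilon> where "\<epsilon> = r / (3 + C)"
  have \<epsilon>: "\<epsilon> > 0" using \<open>r > 0\<close> C(1) by (simp add: \<epsilon>_def)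
  obtain \<delta> L where \<delta>: "0 < \<delta>" "\<delta> \<le> 1 / 2"
    and near: "\<And>m v. m \<ge> L \<Longrightarrow> v > 0 \<Longrightarrow> \<bar>real m / real v - 1\<bar> \<le> \<delta> \<Longrightarrow>
       cmod (f m / of_real (sqrt (real v) ^ k) - c) \<le> \<epsilon>"
    using normalized_sequence_near[OF lim \<epsilon>] by blast
  define Y where "Y n \<omega> = real (N n \<omega>) / real (w n)" for n \<omega>
  have "\<forall>\<epsilon>>0. \<exists>K. \<forall>n\<in>{1..}.
      (\<integral>\<omega>. \<bar>Y n \<omega> ^ k\<bar> * indicator {\<omega>. \<bar>Y n \<omega> ^ k\<bar> > K} \<omega> \<partial>M) < \<epsilon>"
    using ui unfolding uniformly_integrable_def Y_def by (rule conjunct2)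
  then obtain K where "\<forall>n\<in>{1..}.
      (\<integral>\<omega>. \<bar>Y n \<omega> ^ k\<bar> * indicator {\<omega>. \<bar>Y n \<omega> ^ k\<bar> > K} \<omega> \<partial>M) < \<epsilon>"
    using \<epsilon> by blast
  then have K: "(\<integral>\<omega>. \<bar>Y n \<omega> ^ k\<bar> * indicator {\<omega>. \<bar>Y n \<omega> ^ k\<bar> > K} \<omega> \<partial>M) < \<epsilon>"
    if "n \<ge> 1" for n
    using that by simp
  have Y_int: "integrable M (\<lambda>\<omega>. Y n \<omega> ^ k)" if "n \<ge> 1" for n
    using ui that by (auto simp: uniformly_integrable_def Y_def)
  \<comment> \<open>Bounds C (1 + Y^k) + |c| as long as Y^k is at most \<open>K\<close>; the maximum
    covers a negative \<open>K\<close>.\<close>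
  define D where "D = C + cmod c + C * max 0 K"
  have D: "D > 0" using C(1) by (auto simp: D_def intro!: add_pos_nonneg)
  define A where "A n = {\<omega> \<in> space M. \<bar>Y n \<omega> - 1\<bar> > \<delta>}" for n
  define g where "g n \<omega> = f (N n \<omega>) / of_real (sqrt (real (w n)) ^ k)" for n \<omega>
  define h where "h n \<omega> = \<epsilon> + D * indicator (A n) \<omega>
      + C * (\<bar>Y n \<omega> ^ k\<bar> * indicator {\<omega>. \<bar>Y n \<omega> ^ k\<bar> > K} \<omega>)" for n \<omega>
  have "(\<lambda>n. prob (A n)) \<longlonglongrightarrow> 0"
    using conv \<delta>(1) by (simp add: tendsto_in_prob_const_def A_def Y_def)
  moreover have "\<epsilon> / D > 0" using \<epsilon> D by simp
  ultimately have "eventually (\<lambda>n. prob (A n) < \<epsilon> / D) sequentially"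
    by (rule order_tendstoD)
  \<comment> \<open>Together with a ratio of at least 1/2 this puts the index beyond
    \<open>L\<close>.\<close>
  moreover have "eventually (\<lambda>n. w n \<ge> 2 * L) sequentially"
    using w(2) by (auto simp: filterlim_at_top)
  ultimately have "eventually (\<lambda>n. norm ((\<integral>\<omega>. g n \<omega> \<partial>M) - c) < r) sequentially"
    using eventually_ge_at_top[of 1]
  proof eventually_elim
    case (elim n)
    note [measurable] = N[OF \<open>n \<ge> 1\<close>]
    have Y_meas[measurable]: "Y n \<in> borel_measurable M" unfolding Y_def[abs_def] by measurable
    have A_meas[measurable]: "A n \<in> sets M" unfolding A_def by measurable
    have wpos: "w n > 0" using w(1) elim by simp
    have g_bound: "cmod (g n \<omega>) \<le> C * (1 + Y n \<omega> ^ k)" for \<omega>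
    proof -
      have "cmod (g n \<omega>) \<le> C * sqrt (real (N n \<omega>)) ^ k / sqrt (real (w n)) ^ k"
        using C(2)[of "N n \<omega>"] wpos by (simp add: g_def norm_divide norm_power divide_right_mono)
      also have "\<dots> = C * sqrt (Y n \<omega>) ^ k"
        by (simp add: Y_def real_sqrt_divide power_divide)
      also have "\<dots> \<le> C * (1 + Y n \<omega> ^ k)"
        using C(1) by (intro mult_left_mono sqrt_power_le) (auto simp: Y_def)
      finally show ?thesis .
    qed
    have g_int: "integrable M (g n)"
    proof (rule Bochner_Integration.integrable_bound)
      show "integrable M (\<lambda>\<omega>. C * (1 + Y n \<omega> ^ k))" using Y_int elim by simp
      show "AE \<omega> in M. norm (g n \<omega>) \<le> norm (C * (1 + Y n \<omega> ^ k))"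
        by (intro AE_I2 order_trans[OF g_bound]) simp
    qed (unfold g_def[abs_def], measurable)
    have tail_int: "integrable M (\<lambda>\<omega>. \<bar>Y n \<omega> ^ k\<bar> * indicator {\<omega>. \<bar>Y n \<omega> ^ k\<bar> > K} \<omega>)"
    proof (rule Bochner_Integration.integrable_bound[OF Y_int[OF \<open>n \<ge> 1\<close>]])
      show "(\<lambda>\<omega>. \<bar>Y n \<omega> ^ k\<bar> * indicator {\<omega>. \<bar>Y n \<omega> ^ k\<bar> > K} \<omega>) \<in> borel_measurable M"
        unfolding indicator_def by measurable
    qed (auto simp: indicator_def)
    have A_int: "integrable M (indicator (A n) :: _ \<Rightarrow> real)"
      by (simp add: integrable_indicator_iff A_meas emeasure_eq_measure)
    have h_int: "integrable M (h n)"
      unfolding h_def using tail_int A_int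
      by (intro Bochner_Integration.integrable_add integrable_mult_right) auto
    have pointwise: "cmod (g n \<omega> - c) \<le> h n \<omega>" if "\<omega> \<in> space M" for \<omega>
    proof (cases "\<omega> \<in> A n")
      case False
      then have dev: "\<bar>Y n \<omega> - 1\<bar> \<le> \<delta>" using that by (auto simp: A_def)
      then have "Y n \<omega> \<ge> 1 / 2" using \<delta> by linarith
      then have "real (w n) \<le> 2 * real (N n \<omega>)" using wpos by (simp add: Y_def field_simps)
      then have "N n \<omega> \<ge> L" using elim by linarith
      then have "cmod (g n \<omega> - c) \<le> \<epsilon>"
        using near wpos dev by (simp add: g_def Y_def)
      also have "\<dots> \<le> h n \<omega>" using C(1) False by (simp add: h_def)
      finally show ?thesis .
    next
      case True
      have "Y n \<omega> \<ge> 0" by (simp add: Y_def)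
      then have "Y n \<omega> ^ k \<le> max 0 K + \<bar>Y n \<omega> ^ k\<bar> * indicator {\<omega>. \<bar>Y n \<omega> ^ k\<bar> > K} \<omega>"
        by (auto simp: indicator_def)
      from mult_left_mono[OF this, of C] C(1)
      have "C * (1 + Y n \<omega> ^ k) + cmod c \<le> D +
          C * (\<bar>Y n \<omega> ^ k\<bar> * indicator {\<omega>. \<bar>Y n \<omega> ^ k\<bar> > K} \<omega>)"
        by (simp add: D_def distrib_left)
      then show ?thesis
        using g_bound[of \<omega>] norm_triangle_ineq4[of "g n \<omega>" c] True \<epsilon> by (simp add: h_def)
    qed
    have "norm ((\<integral>\<omega>. g n \<omega> \<partial>M) - c) = norm (\<integral>\<omega>. g n \<omega> - c \<partial>M)"
      using g_int by (simp add: prob_space)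
    also have "\<dots> \<le> (\<integral>\<omega>. norm (g n \<omega> - c) \<partial>M)"
      by (rule integral_norm_bound)
    also have "\<dots> \<le> (\<integral>\<omega>. h n \<omega> \<partial>M)"
      using g_int h_int pointwise by (intro integral_mono) auto
    also have "\<dots> = \<epsilon> + D * prob (A n)
        + C * (\<integral>\<omega>. \<bar>Y n \<omega> ^ k\<bar> * indicator {\<omega>. \<bar>Y n \<omega> ^ k\<bar> > K} \<omega> \<partial>M)"
      unfolding h_def using tail_int A_int A_meas by (simp add: prob_space)
    also have "\<dots> < \<epsilon> + \<epsilon> + C * \<epsilon>"
      using elim K[OF \<open>n \<ge> 1\<close>] D C(1) by (intro add_strict_mono add_strict_left_mono mult_strict_left_mono)
        (simp_all add: field_simps)
    also have "\<dots> \<le> (3 + C) * \<epsilon>" using \<epsilon> by (simp add: algebra_simps)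
    also have "\<dots> = r" using C(1) by (simp add: \<epsilon>_def)
    finally show ?case .
  qed
  then show "\<exists>no. \<forall>n\<ge>no. norm ((\<integral>\<omega>. f (N n \<omega>) / of_real (sqrt (real (w n)) ^ k) \<partial>M) - c) < r"
    by (simp add: eventually_sequentially g_def)
qed

section \<open>Moments of the limit laws\<close>

text \<open>Reflecting j into n - j shows that j averages to n/2 under symmetric weights.\<close>

lemma sum_symmetric_weights:
  fixes g :: "nat \<Rightarrow> nat \<Rightarrow> real"
  assumes "\<And>i j. g i j = g j i"
  shows "(\<Sum>j\<le>n. real j * g (n - j) j) = real n / 2 * (\<Sum>j\<le>n. g (n - j) j)"
proof -
  have "(\<Sum>j\<le>n. real j * g (n - j) j) = (\<Sum>j\<le>n. real (n - j) * g (n - j) j)"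
    by (rule sum.reindex_bij_witness[where i = "\<lambda>j. n - j" and j = "\<lambda>j. n - j"]) (auto simp: assms)
  then have "2 * (\<Sum>j\<le>n. real j * g (n - j) j) =
      (\<Sum>j\<le>n. real j * g (n - j) j) + (\<Sum>j\<le>n. real (n - j) * g (n - j) j)" by linarith
  also have "\<dots> = (\<Sum>j\<le>n. (real j + real (n - j)) * g (n - j) j)"
    by (simp only: sum.distrib[symmetric] distrib_right)
  also have "\<dots> = real n * (\<Sum>j\<le>n. g (n - j) j)"
    by (simp add: sum_distrib_left of_nat_diff)
  finally show ?thesis by simp
qed

text \<open>The recurrence is that of the Catalan numbers interleaved with zeros. Multiplied by
  \<open>\<mu> (n - j)\<close> and summed over j, its coefficients linear in j become constants by
  the symmetry of the convolution \<open>S\<close>. This links \<open>S (n + 2)\<close> to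
  \<open>S n\<close>, and the induction hypothesis turns the link into the recurrence for
  \<mu>.\<close>

lemma convolution_of_recurrence:
  fixes \<mu> :: "nat \<Rightarrow> real"
  assumes rec: "\<And>k. real (k + 4) * \<mu> (k + 2) = 4 * real (k + 1) * \<mu> k"
    and "\<mu> 0 = 1" "\<mu> 1 = 0"
  shows "(\<Sum>j\<le>n. \<mu> (n - j) * \<mu> j) = \<mu> (n + 2)"
proof (induction n rule: induct_nat_012)
  case 0
  then show ?case using rec[of 0] assms(2) by simp
next
  case 1
  then show ?case using rec[of 1] assms(3) by (simp add: eval_nat_numeral)
next
  case (ge2 n)
  define S where "S n = (\<Sum>j\<le>n. \<mu> (n - j) * \<mu> j)" for n
  have weights: "(\<Sum>j\<le>n. real j * (\<mu> (n - j) * \<mu> j)) = real n / 2 * S n" for n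
    unfolding S_def by (rule sum_symmetric_weights[where g = "\<lambda>i j. \<mu> i * \<mu> j"]) simp
  have "(\<Sum>j\<le>n. real (j + 4) * \<mu> (j + 2) * \<mu> (n - j)) = (\<Sum>j\<le>n. 4 * real (j + 1) * \<mu> j * \<mu> (n - j))"
    by (intro sum.cong refl arg_cong2[where f = "(*)"] rec)
  also have "\<dots> = 4 * (\<Sum>j\<le>n. real j * (\<mu> (n - j) * \<mu> j)) + 4 * S n"
    unfolding S_def sum_distrib_left sum.distrib[symmetric]
    by (intro sum.cong) (simp_all add: algebra_simps)
  also have "\<dots> = 4 * (real n / 2 + 1) * S n"
    unfolding weights by (simp add: algebra_simps)
  finally have *: "(\<Sum>j\<le>n. real (j + 4) * \<mu> (j + 2) * \<mu> (n - j)) = 4 * (real n / 2 + 1) * S n" .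
  have shift: "(\<Sum>j\<le>n + 2. h j) = h 0 + h 1 + (\<Sum>j\<le>n. h (j + 2))" for h :: "nat \<Rightarrow> real"
    by (simp add: sum.atMost_Suc_shift del: sum.atMost_Suc)
  \<comment> \<open>Of the convolution with weights j + 2, the term j = 0 gives
    \<open>2 * \<mu> (n + 2)\<close>, the term j = 1 vanishes with \<open>\<mu> 1\<close>, and the
    rest is the sum just evaluated.\<close>
  have "(real (n + 2) / 2 + 2) * S (n + 2) = (\<Sum>j\<le>n + 2. real (j + 2) * \<mu> j * \<mu> (n + 2 - j))"
    using weights[of "n + 2"] unfolding S_def
    by (simp add: distrib_right distrib_left sum.distrib sum_distrib_left mult_ac del: sum.atMost_Suc)
  also have "\<dots> = 2 * \<mu> (n + 2) + (\<Sum>j\<le>n. real (j + 4) * \<mu> (j + 2) * \<mu> (n - j))"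
    unfolding shift using assms(2,3) by (simp add: add.commute add.left_commute)
  finally have "(real (n + 2) / 2 + 2) * S (n + 2) = 2 * \<mu> (n + 2) + 4 * (real n / 2 + 1) * S n"
    using * by simp
  moreover have "S n = \<mu> (n + 2)" using ge2 by (simp add: S_def)
  ultimately have "real (n + 6) * S (n + 2) = 4 * real (n + 3) * \<mu> (n + 2)"
    by (simp add: field_simps)
  also have "\<dots> = real (n + 6) * \<mu> (n + 4)"
    using rec[of "n + 2"] by (simp add: eval_nat_numeral algebra_simps)
  finally have "S (n + 2) = \<mu> (n + 4)" by simp
  then show ?case by (simp add: S_def eval_nat_numeral)
qed

lemma semicircle_density_nonneg:
  assumes "- 2 \<le> x" "x \<le> 2"
  shows "0 \<le> sqrt (4 - x\<^sup>2) / (2 * pi)"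
  using mult_nonneg_nonneg[of "2 - x" "2 + x"] assms
  by (simp add: algebra_simps power2_eq_square)

lemma semicircle_moment_recurrence:
  "real (k + 4) * (\<integral>t. t ^ (k + 2) \<partial>semicircle_law) = 4 * real (k + 1) * (\<integral>t. t ^ k \<partial>semicircle_law)"
proof -
  have moment: "(\<integral>t. t ^ k \<partial>semicircle_law) =
      1 / (2 * pi) * integral {-2..2} (\<lambda>t. t ^ k * sqrt (4 - t\<^sup>2))" for k
  proof -
    have "(\<integral>t. t ^ k \<partial>semicircle_law) =
        (\<integral>t. indicator {-2..2} t * (1 / (2 * pi) * sqrt (4 - t\<^sup>2)) * t ^ k \<partial>lborel)"
      unfolding semicircle_law_def
      by (subst integral_density) (auto intro!: AE_I2 semicircle_density_nonneg simp: indicator_def)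
    also have "\<dots> = 1 / (2 * pi) * (LINT t:{-2..2}|lborel. t ^ k * sqrt (4 - t\<^sup>2))"
      by (simp add: set_lebesgue_integral_def mult_ac flip: integral_mult_right_zero)
    also have "(LINT t:{-2..2}|lborel. t ^ k * sqrt (4 - t\<^sup>2)) = integral {-2..2} (\<lambda>t. t ^ k * sqrt (4 - t\<^sup>2))"
      by (intro set_borel_integral_eq_integral(2) borel_integrable_atLeastAtMost' continuous_intros)
    finally show ?thesis .
  qed
  have int: "(\<lambda>t::real. t ^ k * sqrt (4 - t\<^sup>2)) integrable_on {-2..2}" for k
    by (intro integrable_continuous_real continuous_intros)
  \<comment> \<open>The primitive t^{k+1} (4 - t^2)^{3/2} vanishes at both end points, and its
    exponent 3/2 leaves a polynomial times the root in the derivative. The root is not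
    differentiable at the end points, so the derivative is computed in the interior.\<close>
  define F where "F t = t ^ (k + 1) * ((4 - t\<^sup>2) * sqrt (4 - t\<^sup>2))" for t :: real
  have deriv: "(F has_vector_derivative (4 * real (k + 1)) * (t ^ k * sqrt (4 - t\<^sup>2))
      - real (k + 4) * (t ^ (k + 2) * sqrt (4 - t\<^sup>2))) (at t)"
    if "t \<in> {-2<..<2}" for t
  proof -
    define r where "r = sqrt (4 - t\<^sup>2)"
    have "t\<^sup>2 < 2\<^sup>2" using that by (intro power2_strict_mono) auto
    then have pos: "4 - t\<^sup>2 > 0" by simp
    then have r: "r > 0" "r\<^sup>2 = 4 - t\<^sup>2" by (auto simp: r_def)
    have power: "((\<lambda>t. t ^ (k + 1)) has_real_derivative real (k + 1) * t ^ k) (at t)"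
      using DERIV_pow[of "k + 1" t] by simp
    have root: "((\<lambda>t. (4 - t\<^sup>2) * sqrt (4 - t\<^sup>2)) has_real_derivative
        (- (2 * t)) * r + (4 - t\<^sup>2) * (- (2 * t) * (inverse r / 2))) (at t)"
      unfolding r_def using pos by (auto intro!: derivative_eq_intros simp: algebra_simps)
    have "(F has_real_derivative real (k + 1) * t ^ k * ((4 - t\<^sup>2) * r)
        + t ^ (k + 1) * ((- (2 * t)) * r + (4 - t\<^sup>2) * (- (2 * t) * (inverse r / 2)))) (at t)"
      unfolding F_def r_def by (rule DERIV_cong[OF DERIV_mult[OF power root]]) (simp add: r_def mult_ac add_ac)
    also have "(4 - t\<^sup>2) * (- (2 * t) * (inverse r / 2)) = - t * r"
      using r(1) by (simp add: r(2)[symmetric]) (simp add: power2_eq_square)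
    also have "real (k + 1) * t ^ k * ((4 - t\<^sup>2) * r) + t ^ (k + 1) * (- (2 * t) * r + - t * r) =
        (4 * real (k + 1)) * (t ^ k * r) - real (k + 4) * (t ^ (k + 2) * r)"
      by (simp add: algebra_simps power2_eq_square)
    finally show ?thesis
      by (simp add: r_def has_real_derivative_iff_has_vector_derivative)
  qed
  have "continuous_on {-2..2} F"
    unfolding F_def by (intro continuous_intros)
  then have "((\<lambda>t. (4 * real (k + 1)) * (t ^ k * sqrt (4 - t\<^sup>2))
      - real (k + 4) * (t ^ (k + 2) * sqrt (4 - t\<^sup>2))) has_integral F 2 - F (-2)) {-2..2}"
    by (intro fundamental_theorem_of_calculus_interior deriv) auto
  then have "integral {-2..2} (\<lambda>t. (4 * real (k + 1)) * (t ^ k * sqrt (4 - t\<^sup>2))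
      - real (k + 4) * (t ^ (k + 2) * sqrt (4 - t\<^sup>2))) = 0"
    by (simp add: F_def integral_unique)
  then have "4 * real (k + 1) * integral {-2..2} (\<lambda>t. t ^ k * sqrt (4 - t\<^sup>2)) =
      real (k + 4) * integral {-2..2} (\<lambda>t. t ^ (k + 2) * sqrt (4 - t\<^sup>2))"
    using int by (subst (asm) integral_diff) (auto intro!: integrable_on_mult_right simp del: power_Suc power_add)
  then show ?thesis
    unfolding moment by (simp add: field_simps)
qed

lemma integral_odd_function:
  fixes f :: "real \<Rightarrow> real"
  assumes "\<And>x. f (- x) = - f x"
  shows "(\<integral>x. f x \<partial>lborel) = 0"
  using lborel_integral_real_affine[of "-1" f 0] by (simp add: assms)

lemma semicircle_first_moment: "(\<integral>t. t \<partial>semicircle_law) = 0"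
  unfolding semicircle_law_def
  by (subst integral_density)
    (auto intro!: AE_I2 integral_odd_function semicircle_density_nonneg simp: indicator_def)

text \<open>The product of moments is symmetric in n - j and j, so the weight n + 1 - j averages to
  (n + 2)/2 and the convolution identity remains. The value \<open>\<mu> 0 = 1\<close> comes from
  the hypothesis \<open>prob_space semicircle_law\<close>.\<close>

lemma semicircle_moments:
  fixes n :: nat
  defines "\<mu> \<equiv> \<lambda>k. \<integral>t. t ^ k \<partial>semicircle_law"
  assumes "prob_space semicircle_law"
  shows "real (n + 2) / 2 * \<mu> (n + 2) = (\<Sum>j\<le>n. real (n + 1 - j) * (\<mu> (n - j) * \<mu> j))"
proof -
  interpret prob_space semicircle_law by fact
  have \<mu>: "\<mu> 0 = 1" "\<mu> 1 = 0"
    using prob_space semicircle_first_moment by (simp_all add: \<mu>_def)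
  have S: "(\<Sum>j\<le>n. \<mu> (n - j) * \<mu> j) = \<mu> (n + 2)"
    using \<mu> unfolding \<mu>_def
    by (intro convolution_of_recurrence semicircle_moment_recurrence)
  have weights: "(\<Sum>j\<le>n. real j * (\<mu> (n - j) * \<mu> j)) = real n / 2 * \<mu> (n + 2)"
    unfolding S[symmetric] by (rule sum_symmetric_weights[where g = "\<lambda>i j. \<mu> i * \<mu> j"]) simp
  have "(\<Sum>j\<le>n. real (n + 1 - j) * (\<mu> (n - j) * \<mu> j)) =
      (\<Sum>j\<le>n. real (n + 1) * (\<mu> (n - j) * \<mu> j) - real j * (\<mu> (n - j) * \<mu> j))"
    by (intro sum.cong) (auto simp: of_nat_diff left_diff_distrib)
  also have "\<dots> = real (n + 1) * \<mu> (n + 2) - real n / 2 * \<mu> (n + 2)"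
    by (simp only: sum_subtractf sum_distrib_left[symmetric] S weights)
  finally show ?thesis by (simp add: field_simps)
qed

lemma std_normal_moments:
  defines "\<mu> \<equiv> \<lambda>k. \<integral>t. t ^ k \<partial>std_normal_distribution"
  shows "\<mu> 0 = 1" "\<mu> 1 = 0" "\<mu> (n + 2) = real (n + 1) * \<mu> n"
proof -
  have \<mu>: "\<mu> k = (\<integral>t. std_normal_density t * t ^ k \<partial>lborel)" for k
    unfolding \<mu>_def by (subst integral_density) auto
  have even: "\<mu> (2 * k) = fact (2 * k) / (2 ^ k * fact k)" for k
    unfolding \<mu> by (rule integral_std_normal_moment_even)
  have odd: "\<mu> (2 * k + 1) = 0" for k
    unfolding \<mu> by (rule integral_std_normal_moment_odd)
  show "\<mu> 0 = 1" using even[of 0] by simp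
  show "\<mu> 1 = 0" using odd[of 0] by simp
  show "\<mu> (n + 2) = real (n + 1) * \<mu> n"
  proof (cases "even n")
    case True
    then obtain k where k: "n = 2 * k" by auto
    have "\<mu> (2 * Suc k) = fact (2 * Suc k) / (2 ^ Suc k * fact (Suc k))" by (rule even)
    also have "\<dots> = (2 * real (k + 1) * (real (2 * k + 1) * fact (2 * k))) / (2 * real (k + 1) * (2 ^ k * fact k))"
      by (simp add: algebra_simps)
    also have "\<dots> = real (n + 1) * \<mu> n"
      unfolding k even by (subst mult_divide_mult_cancel_left) auto
    finally show ?thesis by (simp add: k)
  next
    case False
    then obtain k where k: "n = 2 * k + 1" by (auto elim: oddE)
    show ?thesis using odd[of k] odd[of "Suc k"] by (simp add: k)
  qed
qed

text \<open>Integration by parts with the primitive |t| exp(-t^2) t^{n+1}, which vanishes at both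
  infinities.\<close>

lemma symmetrized_rayleigh_moments:
  fixes n :: nat
  defines "\<mu> \<equiv> \<lambda>k. \<integral>t. t ^ k \<partial>symmetrized_rayleigh_law"
  assumes int: "\<And>k. integrable symmetrized_rayleigh_law (\<lambda>t. t ^ k)"
  shows "\<mu> 1 = 0" "\<mu> (n + 2) = real (n + 2) / 2 * \<mu> n"
proof -
  define g where "g k t = \<bar>t\<bar> * exp (- t\<^sup>2) * t ^ k" for k and t :: real
  have \<mu>: "\<mu> k = (\<integral>t. g k t \<partial>lborel)" for k
    unfolding \<mu>_def symmetrized_rayleigh_law_def g_def by (subst integral_density) auto
  have g_int: "integrable lborel (g k)" for k
    using int[of k] unfolding symmetrized_rayleigh_law_def g_def
    by (subst (asm) integrable_density) auto
  show "\<mu> 1 = 0"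
    unfolding \<mu> by (rule integral_odd_function) (simp add: g_def)
  define F where "F t = g (n + 1) t" for t
  have deriv: "(F has_real_derivative real (n + 2) * g n t - 2 * g (n + 2) t) (at t)" for t
  proof (cases "t = 0")
    case True
    \<comment> \<open>The kink of |t| at 0 is harmless: the extra factor t leaves |h| exp(-h^2) h^n
      as difference quotient.\<close>
    have "((\<lambda>h::real. \<bar>h\<bar> * exp (- h\<^sup>2) * h ^ n) \<longlongrightarrow> \<bar>0\<bar> * exp (- 0\<^sup>2) * 0 ^ n) (at 0)"
      by (intro tendsto_intros)
    then have "((\<lambda>h::real. \<bar>h\<bar> * exp (- h\<^sup>2) * h ^ n) \<longlongrightarrow> 0) (at 0)"
      by simp
    then have "((\<lambda>h. (F h - F 0) / (h - 0)) \<longlongrightarrow> 0) (at 0)"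
      by (rule Lim_transform_eventually) (auto simp: F_def g_def eventually_at_filter)
    then show ?thesis
      by (simp add: has_field_derivative_iff True g_def)
  next
    case False
    \<comment> \<open>Away from 0 the sign is locally constant, so |t| may be replaced by a smooth
      function.\<close>
    define \<sigma> where "\<sigma> = sgn t"
    have "((\<lambda>t. \<sigma> * t * exp (- t\<^sup>2) * t ^ (n + 1)) has_real_derivative
        real (n + 2) * (\<sigma> * t * exp (- t\<^sup>2) * t ^ n) - 2 * (\<sigma> * t * exp (- t\<^sup>2) * t ^ (n + 2))) (at t)"
    proof -
      have power: "((\<lambda>t. t ^ (n + 2)) has_real_derivative real (n + 2) * t ^ (n + 1)) (at t)"
        using DERIV_pow[of "n + 2" t] by simp
      have gauss: "((\<lambda>t. \<sigma> * exp (- t\<^sup>2)) has_real_derivative \<sigma> * (exp (- t\<^sup>2) * (- (2 * t)))) (at t)"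
        by (auto intro!: derivative_eq_intros)
      show ?thesis
        using DERIV_mult[OF gauss power] by (simp add: algebra_simps)
    qed
    moreover have "eventually (\<lambda>u. \<sigma> * u * exp (- u\<^sup>2) * u ^ (n + 1) = F u) (nhds t)"
    proof (cases "t > 0")
      case True
      have "eventually (\<lambda>u. u \<in> {0<..}) (nhds t)"
        using True by (intro eventually_nhds_in_open) auto
      then show ?thesis by eventually_elim (use True in \<open>auto simp: F_def g_def \<sigma>_def\<close>)
    next
      case 2: False
      have "eventually (\<lambda>u. u \<in> {..<0}) (nhds t)"
        using 2 False by (intro eventually_nhds_in_open) auto
      then show ?thesis by eventually_elim (use 2 False in \<open>auto simp: F_def g_def \<sigma>_def\<close>)
    qed
    moreover have "\<sigma> * t = \<bar>t\<bar>" by (simp add: \<sigma>_def abs_sgn mult.commute)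
    ultimately show ?thesis
      by (subst (asm) DERIV_cong_ev[OF refl _ refl]) (auto simp: g_def mult_ac)
  qed
  have top: "(F \<longlongrightarrow> 0) at_top"
  proof (rule Lim_null_comparison[OF _ tendsto_power_div_exp_0])
    show "eventually (\<lambda>t. norm (F t) \<le> t ^ (n + 2) / exp t) at_top"
      using eventually_ge_at_top[of 1]
    proof eventually_elim
      case (elim t)
      have "exp (- t\<^sup>2) \<le> exp (- t)" using elim by (simp add: power2_eq_square)
      then have "exp (- t\<^sup>2) * t ^ (n + 2) \<le> exp (- t) * t ^ (n + 2)"
        using elim by (intro mult_right_mono) auto
      then show ?case using elim
        by (simp add: F_def g_def exp_minus field_simps abs_mult)
    qed
  qed
  \<comment> \<open>Parity reduces the limit at minus infinity to the one at plus infinity.\<close>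
  have "F (- t) = (- 1) ^ (n + 1) * F t" for t
    unfolding F_def g_def power_minus[of t "n + 1"] by simp
  then have bot: "(F \<longlongrightarrow> 0) at_bot"
    using tendsto_mult_right_zero[OF top, of "(- 1) ^ (n + 1)"] by (simp add: filterlim_at_bot_mirror)
  have int': "integrable lborel (\<lambda>t. real (n + 2) * g n t - 2 * g (n + 2) t)"
    using g_int by (intro Bochner_Integration.integrable_diff integrable_mult_right)
  have "(LBINT t=-\<infinity>..\<infinity>. real (n + 2) * g n t - 2 * g (n + 2) t) = 0 - 0"
  proof (rule interval_integral_FTC_integrable[where F = F])
    show "(F has_vector_derivative real (n + 2) * g n t - 2 * g (n + 2) t) (at t)" for t
      using deriv by (simp add: has_real_derivative_iff_has_vector_derivative)
    show "isCont (\<lambda>t. real (n + 2) * g n t - 2 * g (n + 2) t) t" for t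
      unfolding g_def by (intro continuous_intros)
    show "set_integrable lborel (einterval (-\<infinity>) \<infinity>) (\<lambda>t. real (n + 2) * g n t - 2 * g (n + 2) t)"
      using int' by (simp add: set_integrable_def)
  qed (use top bot in \<open>simp_all add: ereal_tendsto_simps\<close>)
  then have "(\<integral>t. real (n + 2) * g n t - 2 * g (n + 2) t \<partial>lborel) = 0"
    by (simp add: interval_integral_to_infinity_eq interval_lebesgue_integral_def set_lebesgue_integral_def)
  then have "real (n + 2) * \<mu> n - 2 * \<mu> (n + 2) = 0"
    by (subst (asm) Bochner_Integration.integral_diff)
      (simp_all only: integral_mult_right_zero integrable_mult_right g_int \<mu>[symmetric])
  then show "\<mu> (n + 2) = real (n + 2) / 2 * \<mu> n" by simp
qed

section \<open>Words and their spans\<close>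

lemma count_list_replicate: "count_list (replicate n x) y = (if x = y then n else 0)"
  by (induction n) auto

context nc_prob_space
begin

lemma \<phi>_add: "\<phi> (x + y) = \<phi> x + \<phi> y"
  and \<phi>_scale: "\<phi> (smul c x) = c * \<phi> x"
proof -
  interpret functional: Vector_Spaces.linear smul "(*)" \<phi> by (rule functional_linear)
  show "\<phi> (x + y) = \<phi> x + \<phi> y" "\<phi> (smul c x) = c * \<phi> x"
    by (rule functional.add functional.scale)+
qed

lemma \<phi>_zero: "\<phi> 0 = 0"
  using \<phi>_scale[of 0 0] by simp

lemma \<phi>_diff: "\<phi> (x - y) = \<phi> x - \<phi> y"
  using \<phi>_add[of "x - y" y] by simp

lemma \<phi>_sum: "\<phi> (\<Sum>i\<in>A. f i) = (\<Sum>i\<in>A. \<phi> (f i))"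
  by (induction A rule: infinite_finite_induct) (simp_all add: \<phi>_zero \<phi>_add)

lemma scale_power: "smul c x ^ k = smul (c ^ k) (x ^ k)"
  by (induction k) (simp_all add: scale_mult_left scale_mult_right mult.commute)

lemma alg_poly_eq:
  assumes "degree p \<le> n"
  shows "alg_poly smul p x = (\<Sum>k\<le>n. smul (coeff p k) (x ^ k))"
  unfolding alg_poly_def using assms
  by (intro sum.mono_neutral_left) (auto simp: coeff_eq_0)

lemma alg_poly_pCons: "alg_poly smul (pCons c p) x = smul c 1 + x * alg_poly smul p x"
proof -
  have "alg_poly smul (pCons c p) x = (\<Sum>k\<le>Suc (degree p). smul (coeff (pCons c p) k) (x ^ k))"
    by (rule alg_poly_eq) (simp add: degree_pCons_le)
  then show ?thesis
    by (simp add: alg_poly_def sum.atMost_Suc_shift sum_distrib_left scale_mult_right del: sum.atMost_Suc)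
qed

lemma alg_poly_0: "alg_poly smul 0 x = 0"
  by (simp add: alg_poly_def)

lemma alg_poly_add: "alg_poly smul (p + q) x = alg_poly smul p x + alg_poly smul q x"
proof -
  let ?n = "max (degree p) (degree q)"
  have "degree (p + q) \<le> ?n" by (rule degree_add_le_max)
  then show ?thesis
    by (simp add: alg_poly_eq[of _ ?n] scale_left_distrib sum.distrib)
qed

lemma alg_poly_diff_const: "alg_poly smul (p - [:c:]) x = alg_poly smul p x - smul c 1"
  using alg_poly_add[of "p - [:c:]" "[:c:]" x] by (simp add: alg_poly_pCons alg_poly_0)

lemma alg_poly_monom: "alg_poly smul (monom 1 k) x = x ^ k"
proof (induction k)
  case (Suc k)
  then show ?case by (simp add: monom_Suc alg_poly_pCons)
qed (simp add: alg_poly_def)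

lemma alg_poly_mult_var: "alg_poly smul p x * x = alg_poly smul (pCons 0 p) x"
proof -
  have "x * alg_poly smul p x = alg_poly smul p x * x"
    by (simp add: alg_poly_def sum_distrib_left sum_distrib_right scale_mult_left scale_mult_right
        power_commutes)
  then show ?thesis by (simp add: alg_poly_pCons)
qed

definition centered :: "complex poly \<Rightarrow> 'a \<Rightarrow> complex poly" where
  "centered p x = p - [:\<phi> (alg_poly smul p x):]"

lemma \<phi>_centered: "\<phi> (alg_poly smul (centered p x) x) = 0"
  by (simp add: centered_def alg_poly_diff_const \<phi>_diff \<phi>_scale functional_one)

lemma alg_poly_centered:
  "alg_poly smul p x = alg_poly smul (centered p x) x + smul (\<phi> (alg_poly smul p x)) 1"
  by (simp add: centered_def alg_poly_diff_const)

text \<open>The span of these products is the unital subalgebra generated by the \<open>b i\<close>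
  with \<open>i \<in> J\<close>.\<close>

abbreviation words :: "('i \<Rightarrow> 'a) \<Rightarrow> 'i set \<Rightarrow> 'a set" where
  "words b J \<equiv> {prod_list (map b is) |is. set is \<subseteq> J}"

lemma span_mult:
  assumes "\<And>s t. s \<in> S \<Longrightarrow> t \<in> T \<Longrightarrow> s * t \<in> span U" and "x \<in> span S" "y \<in> span T"
  shows "x * y \<in> span U"
  using \<open>x \<in> span S\<close>
proof (induction rule: span_induct_alt)
  case (step c s z)
  have "s * y \<in> span U"
    using \<open>y \<in> span T\<close>
  proof (induction rule: span_induct_alt)
    case (step d t u)
    then show ?case
      using assms(1)[OF \<open>s \<in> S\<close>] by (simp add: distrib_left scale_mult_right span_add span_scale)
  qed (simp add: span_zero)
  then show ?case
    using step by (simp add: distrib_right scale_mult_left span_add span_scale)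
qed (simp add: span_zero)

lemma span_words_mult:
  assumes "x \<in> span (words b J)" "y \<in> span (words b J)"
  shows "x * y \<in> span (words b J)"
proof (rule span_mult[OF _ assms])
  fix s t assume "s \<in> words b J" "t \<in> words b J"
  then obtain "is" js where "s = prod_list (map b is)" "t = prod_list (map b js)"
    "set is \<subseteq> J" "set js \<subseteq> J" by auto
  then have "s * t = prod_list (map b (is @ js))" "set (is @ js) \<subseteq> J" by auto
  then have "s * t \<in> words b J" by blast
  then show "s * t \<in> span (words b J)" by (rule span_base)
qed

lemma span_words_one: "1 \<in> span (words b J)"
  by (rule span_base) (auto intro!: exI[of _ "[]"])

lemma span_words_var:
  assumes "i \<in> J"
  shows "b i \<in> span (words b J)"
  using assms by (intro span_base) (auto intro!: exI[of _ "[i]"])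

lemma span_words_power: "x \<in> span (words b J) \<Longrightarrow> x ^ k \<in> span (words b J)"
  by (induction k) (auto intro: span_words_one span_words_mult)

lemma span_words_alg_poly: "x \<in> span (words b J) \<Longrightarrow> alg_poly smul p x \<in> span (words b J)"
  unfolding alg_poly_def by (intro span_sum span_scale span_words_power)

lemma span_words_sum_vars: "finite J \<Longrightarrow> (\<Sum>i\<in>J. b i) \<in> span (words b J)"
  by (intro span_sum span_words_var)

text \<open>General enough for multiplication by a fixed element, scaling, the identity and the zero
  map, which are the choices made later.\<close>

lemma span_functional_eq:
  assumes "\<And>s. s \<in> S \<Longrightarrow> \<phi> (f s) = \<phi> (g s)" "x \<in> span S"
    and "\<And>u v. f (u + v) = f u + f v" "\<And>c u. f (smul c u) = smul c (f u)"
    and "\<And>u v. g (u + v) = g u + g v" "\<And>c u. g (smul c u) = smul c (g u)"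
  shows "\<phi> (f x) = \<phi> (g x)"
  using assms(2)
proof (induction rule: span_induct_alt)
  case base
  show ?case using assms(4)[of 0 0] assms(6)[of 0 0] by simp
next
  case (step c s y)
  then show ?case using assms(1) by (simp add: assms(3-6) \<phi>_add \<phi>_scale)
qed

section \<open>Sums with asymptotically negligible increments\<close>

text \<open>The terms are sorted by the length i of the leading run of x, and what follows the first
  y stays unexpanded. Three applications separate the words with none, one, two and at least three
  letters y.\<close>

lemma power_add_expand:
  fixes x y :: 'a
  shows "(x + y) ^ k = x ^ k + (\<Sum>i<k. x ^ i * y * (x + y) ^ (k - 1 - i))"
proof (induction k)
  case (Suc k)
  have "(x + y) ^ Suc k = x * (x + y) ^ k + y * (x + y) ^ k" by (simp add: distrib_right)
  also have "x * (x + y) ^ k = x ^ Suc k + (\<Sum>i<k. x ^ Suc i * y * (x + y) ^ (k - 1 - i))"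
    by (subst Suc) (simp add: distrib_left sum_distrib_left mult.assoc)
  finally show ?case
    by (simp add: sum.lessThan_Suc_shift del: sum.lessThan_Suc)
qed simp

text \<open>Letters are indexed by \<open>bool\<close>, with \<open>True\<close> for the new
  variable y, so that results on indexed families apply to the pair of letters.\<close>

definition word2 :: "'a \<Rightarrow> 'a \<Rightarrow> bool list \<Rightarrow> 'a" where
  "word2 x y ts = prod_list (map (\<lambda>t. if t then y else x) ts)"

lemma word2_simps [simp]:
  "word2 x y [] = 1" "word2 x y (t # ts) = (if t then y else x) * word2 x y ts"
  "word2 x y (ts @ us) = word2 x y ts * word2 x y us"
  "word2 x y (replicate k t) = (if t then y else x) ^ k"
  by (simp_all add: word2_def)

text \<open>Expanding one factor of the power doubles the number of words; \<open>r \<ge> 1\<close>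
  allows a letter y to be charged like a letter x.\<close>

lemma bounded_word_power:
  assumes bound: "\<And>ts. length ts = k \<Longrightarrow> count_list ts False \<le> p \<Longrightarrow> cmod (\<phi> (word2 x y ts)) \<le> C * r ^ count_list ts False"
    and "r \<ge> 1" "C \<ge> 0" "length ts + n = k" "count_list ts False + n \<le> p"
  shows "cmod (\<phi> (word2 x y ts * (x + y) ^ n)) \<le> 2 ^ n * C * r ^ (count_list ts False + n)"
  using assms(4,5)
proof (induction n arbitrary: ts)
  case 0
  then show ?case using bound by simp
next
  case (Suc n)
  have "word2 x y ts * (x + y) ^ Suc n =
      word2 x y (ts @ [False]) * (x + y) ^ n + word2 x y (ts @ [True]) * (x + y) ^ n"
    by (simp add: distrib_left distrib_right mult.assoc)
  then have "cmod (\<phi> (word2 x y ts * (x + y) ^ Suc n)) \<le>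
      cmod (\<phi> (word2 x y (ts @ [False]) * (x + y) ^ n)) + cmod (\<phi> (word2 x y (ts @ [True]) * (x + y) ^ n))"
    by (simp only: \<phi>_add norm_triangle_ineq)
  also have "\<dots> \<le> 2 ^ n * C * r ^ (count_list (ts @ [False]) False + n)
      + 2 ^ n * C * r ^ (count_list (ts @ [True]) False + n)"
    using Suc.prems by (intro add_mono Suc.IH) auto
  also have "\<dots> \<le> 2 ^ n * C * r ^ (count_list ts False + Suc n) + 2 ^ n * C * r ^ (count_list ts False + Suc n)"
  proof -
    have "count_list (ts @ [False]) False = Suc (count_list ts False)"
      "count_list (ts @ [True]) False = count_list ts False"
      by simp_all
    then show ?thesis
      using assms(2,3) by (auto intro!: add_mono mult_left_mono power_increasing simp del: power_Suc)
  qed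
  finally show ?case by (simp add: mult_ac)
qed


text \<open>
  Expanding \<open>a (Suc m) ^ k = (a m + c m) ^ k\<close>, the words with one \<open>c m\<close> do not contribute, those
  with two are given by \<open>t\<close>, and those with at least three are negligible.
\<close>

lemma moments_limit_of_increments:
  fixes a c :: "nat \<Rightarrow> 'a" and \<mu> :: "nat \<Rightarrow> real" and \<theta> :: "nat \<Rightarrow> nat \<Rightarrow> real"
  assumes F_def: "F = (\<lambda>k m. \<phi> (a m ^ k) / of_real (sqrt (real m) ^ k))"
    and a: "\<And>m. a (Suc m) = a m + c m"
    and first_moment: "\<And>m. \<phi> (a m) = 0"
    and one: "\<And>m i l. \<phi> (a m ^ i * c m * a m ^ l) = 0"
    and two: "\<And>m i j l. \<phi> (a m ^ i * c m * a m ^ j * c m * a m ^ l) = t m (i + l) j"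
    and two_limit: "\<And>p j. (\<And>r. r \<le> p + j \<Longrightarrow> F r \<longlonglongrightarrow> of_real (\<mu> r)) \<Longrightarrow>
      (\<lambda>m. t m p j / of_real (sqrt (real m) ^ (p + j))) \<longlonglongrightarrow> of_real (\<theta> p j)"
    and bound: "\<And>k p K. \<exists>C. \<forall>m\<ge>1. (\<forall>j\<le>p. cmod (F j m) \<le> K) \<longrightarrow>
      (\<forall>ts. length ts = k \<longrightarrow> count_list ts False \<le> p \<longrightarrow>
        cmod (\<phi> (word2 (a m) (c m) ts)) \<le> C * sqrt (real m) ^ count_list ts False)"
    and \<mu>: "\<mu> 0 = 1" "\<mu> 1 = 0"
      "\<And>n. real (n + 2) / 2 * \<mu> (n + 2) = (\<Sum>j\<le>n. real (n + 1 - j) * \<theta> (n - j) j)"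
  shows "F k \<longlonglongrightarrow> of_real (\<mu> k)"
proof (induction k rule: less_induct)
  case (less k)
  consider "k = 0" | "k = 1" | n where "k = n + 2"
    by (metis One_nat_def add_2_eq_Suc' not0_implies_Suc)
  then show ?case
  proof cases
    case 1
    then show ?thesis by (simp add: F_def functional_one \<mu>)
  next
    case 2
    then show ?thesis using \<mu>(2) by (simp add: F_def first_moment)
  next
    case (3 n)
    define two_terms where "two_terms m = (\<Sum>j\<le>n. of_nat (n + 1 - j) * t m (n - j) j)" for m
    \<comment> \<open>The indices are the lengths of the runs of \<open>a m\<close> before the first
      three letters \<open>c m\<close>.\<close>
    define I3 where "I3 = (SIGMA i:{..<k}. SIGMA j:{..<k - 1 - i}. {..<k - 1 - i - 1 - j})"
    define R where "R m = (\<Sum>(i, j, l)\<in>I3. \<phi> (a m ^ i * c m * (a m ^ j * c m * (a m ^ l * c m *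
      (a m + c m) ^ (k - 1 - i - 1 - j - 1 - l)))))" for m
    have fin: "finite I3" unfolding I3_def by auto
    have increment: "\<phi> (a (Suc m) ^ k) - \<phi> (a m ^ k) = two_terms m + R m" for m
    proof -
      let ?x = "a m" and ?y = "c m"
      define T where "T = (\<Sum>i<k. \<Sum>j<k - 1 - i. \<phi> (?x ^ i * ?y * (?x ^ j * ?y * ?x ^ (k - 1 - i - 1 - j))))"
      have "(?x + ?y) ^ k = ?x ^ k + (\<Sum>i<k. ?x ^ i * ?y * ?x ^ (k - 1 - i))
          + (\<Sum>i<k. \<Sum>j<k - 1 - i. ?x ^ i * ?y * (?x ^ j * ?y * ?x ^ (k - 1 - i - 1 - j)))
          + (\<Sum>i<k. \<Sum>j<k - 1 - i. \<Sum>l<k - 1 - i - 1 - j. ?x ^ i * ?y * (?x ^ j * ?y *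
              (?x ^ l * ?y * (?x + ?y) ^ (k - 1 - i - 1 - j - 1 - l))))"
        by (subst power_add_expand[of _ _ k], subst power_add_expand[of _ _ "k - 1 - _"],
            subst power_add_expand[of _ _ "k - 1 - _ - 1 - _"])
          (simp only: distrib_left sum.distrib sum_distrib_left add.assoc)
      then have "\<phi> (a (Suc m) ^ k) = \<phi> (?x ^ k) + T + R m"
        by (simp add: a \<phi>_add \<phi>_sum one T_def R_def I3_def sum.Sigma case_prod_unfold)
      moreover have "T = two_terms m"
      proof -
        have "T = (\<Sum>i<k. \<Sum>j<k - 1 - i. t m (n - j) j)"
          unfolding T_def
        proof (intro sum.cong refl)
          fix i j assume "i \<in> {..<k}" "j \<in> {..<k - 1 - i}"
          then have "i + (k - 1 - i - 1 - j) = n - j" using 3 by auto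
          then show "\<phi> (?x ^ i * ?y * (?x ^ j * ?y * ?x ^ (k - 1 - i - 1 - j))) = t m (n - j) j"
            using two[of m i j "k - 1 - i - 1 - j"] by (simp add: mult.assoc)
        qed
        \<comment> \<open>For given j the outer runs have total length n - j, which leaves n + 1 - j
          choices of i.\<close>
        also have "\<dots> = (\<Sum>j\<le>n. \<Sum>i<n + 1 - j. t m (n - j) j)"
          unfolding sum.Sigma[OF finite_lessThan ballI[OF finite_lessThan]]
            sum.Sigma[OF finite_atMost ballI[OF finite_lessThan]]
          by (rule sum.reindex_bij_witness[where i = prod.swap and j = prod.swap]) (use 3 in auto)
        also have "\<dots> = two_terms m" by (simp add: two_terms_def)
        finally show ?thesis .
      qed
      ultimately show ?thesis by simp
    qed
    have IH: "F r \<longlonglongrightarrow> of_real (\<mu> r)" if "r \<le> n" for r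
      using less.IH[of r] that 3 by simp
    have "(\<lambda>m. \<Sum>j\<le>n. of_nat (n + 1 - j) * (t m (n - j) j / of_real (sqrt (real m) ^ (n - j + j))))
        \<longlonglongrightarrow> (\<Sum>j\<le>n. of_nat (n + 1 - j) * of_real (\<theta> (n - j) j))"
      by (intro tendsto_intros two_limit IH) auto
    also have "(\<Sum>j\<le>n. of_nat (n + 1 - j) * of_real (\<theta> (n - j) j)) = complex_of_real (real (n + 2) / 2 * \<mu> (n + 2))"
      unfolding \<mu>(3) by simp
    finally have two_terms: "(\<lambda>m. two_terms m / of_real (sqrt (real m) ^ n))
        \<longlonglongrightarrow> of_real (real (n + 2) / 2 * \<mu> (n + 2))"
      by (simp add: two_terms_def sum_divide_distrib)
    have R: "(\<lambda>m. R m / of_real (sqrt (real m) ^ n)) \<longlonglongrightarrow> 0"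
    proof -
      \<comment> \<open>Convergent sequences are bounded, so one \<open>K\<close> serves all orders
        up to n and all m, and the constant obtained from \<open>bound\<close> is independent of
        m.\<close>
      have "bounded (\<Union>j\<in>{..n}. range (F j))"
        using IH by (intro bounded_UN) (auto intro: convergent_imp_bounded)
      then obtain K where K: "\<And>j m. j \<le> n \<Longrightarrow> cmod (F j m) \<le> K"
        unfolding bounded_iff by fastforce
      obtain C0 where C0: "\<And>m ts. m \<ge> 1 \<Longrightarrow> length ts = k \<Longrightarrow> count_list ts False \<le> n \<Longrightarrow>
          cmod (\<phi> (word2 (a m) (c m) ts)) \<le> C0 * sqrt (real m) ^ count_list ts False"
        using bound[of n K k] K by blast
      define C where "C = \<bar>C0\<bar>"
      have C: "cmod (\<phi> (word2 (a m) (c m) ts)) \<le> C * sqrt (real m) ^ count_list ts False"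
        if "m \<ge> 1" "length ts = k" "count_list ts False \<le> n" for m ts
        using order_trans[OF C0[OF that] mult_right_mono[of C0 C]] by (simp add: C_def)
      have "(\<lambda>m. \<phi> (a m ^ i * c m * (a m ^ j * c m * (a m ^ l * c m *
            (a m + c m) ^ (k - 1 - i - 1 - j - 1 - l)))) / of_real (sqrt (real m) ^ n)) \<longlonglongrightarrow> 0"
        if "(i, j, l) \<in> I3" for i j l
      proof -
        define q where "q = k - 1 - i - 1 - j - 1 - l"
        \<comment> \<open>At least three of the k = n + 2 letters are \<open>c m\<close>, so at most
          n - 1 are \<open>a m\<close>: one factor sqrt m is left over in the denominator.\<close>
        have n: "i + j + l + q = n - 1" "n \<ge> 1" using that 3 by (auto simp: I3_def q_def)
        define ts where "ts = replicate i False @ [True] @ replicate j False @ [True] @ replicate l False @ [True]"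
        have ts: "length ts + q = k" "count_list ts False = i + j + l"
          using n 3 by (auto simp: ts_def count_list_replicate)
        have split: "sqrt (real m) ^ n = sqrt (real m) * sqrt (real m) ^ (n - 1)" for m
          using n(2) by (cases n) auto
        show ?thesis
          unfolding q_def[symmetric]
        proof (rule Lim_null_comparison)
          show "(\<lambda>m. 2 ^ q * C * (1 / sqrt (real m))) \<longlonglongrightarrow> 0"
            by (rule tendsto_mult_right_zero) real_asymp
          show "eventually (\<lambda>m. norm (\<phi> (a m ^ i * c m * (a m ^ j * c m * (a m ^ l * c m *
            (a m + c m) ^ q))) / of_real (sqrt (real m) ^ n))
            \<le> 2 ^ q * C * (1 / sqrt (real m))) sequentially"
            using eventually_ge_at_top[of 1]
          proof eventually_elim
            case (elim m)
            have "cmod (\<phi> (word2 (a m) (c m) ts * (a m + c m) ^ q)) \<le>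
                2 ^ q * C * sqrt (real m) ^ (count_list ts False + q)"
              using elim ts n by (intro bounded_word_power[where k = k and p = n] C) (auto simp: C_def)
            also have "word2 (a m) (c m) ts * (a m + c m) ^ q = a m ^ i * c m * (a m ^ j * c m *
                (a m ^ l * c m * (a m + c m) ^ q))"
              by (simp add: ts_def mult.assoc)
            also have "count_list ts False + q = n - 1" using ts n by simp
            finally have "cmod (\<phi> (a m ^ i * c m * (a m ^ j * c m * (a m ^ l * c m * (a m + c m) ^ q))))
                / sqrt (real m) ^ n \<le> 2 ^ q * C * sqrt (real m) ^ (n - 1) / sqrt (real m) ^ n"
              by (intro divide_right_mono) auto
            also have "\<dots> = 2 ^ q * C * (1 / sqrt (real m))"
              using elim by (simp add: split)
            finally show ?case by (simp only: norm_divide norm_of_real) (simp add: norm_power)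
          qed
        qed
      qed
      then have "(\<lambda>m. \<Sum>p\<in>I3. (case p of (i, j, l) \<Rightarrow> \<phi> (a m ^ i * c m * (a m ^ j * c m * (a m ^ l * c m *
            (a m + c m) ^ (k - 1 - i - 1 - j - 1 - l))))) / of_real (sqrt (real m) ^ n)) \<longlonglongrightarrow> 0"
        by (intro tendsto_null_sum) auto
      then show ?thesis by (simp add: R_def sum_divide_distrib)
    qed
    have "(\<lambda>m. two_terms m / of_real (sqrt (real m) ^ n) + R m / of_real (sqrt (real m) ^ n))
        \<longlonglongrightarrow> of_real (real (n + 2) / 2 * \<mu> (n + 2)) + 0"
      by (intro tendsto_add two_terms R)
    then have "(\<lambda>m. (\<phi> (a (Suc m) ^ k) - \<phi> (a m ^ k)) / of_real (sqrt (real m) ^ (k - 2)))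
        \<longlonglongrightarrow> of_nat k / 2 * of_real (\<mu> k)"
      unfolding increment add_divide_distrib by (simp add: 3)
    then show ?thesis
      unfolding F_def by (rule tendsto_of_increments[rotated]) (simp add: 3)
  qed
qed

end

section \<open>Free families\<close>

context nc_prob_space
begin

definition poly_word :: "('i \<Rightarrow> 'a) \<Rightarrow> ('i \<times> complex poly) list \<Rightarrow> 'a" where
  "poly_word b ips = prod_list (map (\<lambda>(i, p). alg_poly smul p (b i)) ips)"

lemma poly_word_simps [simp]:
  "poly_word b [] = 1" "poly_word b ((i, p) # ips) = alg_poly smul p (b i) * poly_word b ips"
  "poly_word b (ips @ jps) = poly_word b ips * poly_word b jps"
  by (simp_all add: poly_word_def)

definition alternating :: "('i \<Rightarrow> 'a) \<Rightarrow> 'i set \<Rightarrow> ('i \<times> complex poly) list \<Rightarrow> bool" where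
  "alternating b J ips \<longleftrightarrow>
     (\<forall>z \<in> set ips. fst z \<in> J \<and> \<phi> (alg_poly smul (snd z) (b (fst z))) = 0) \<and> successively (\<noteq>) (map fst ips)"

lemma free_family_iff:
  "free_family smul \<phi> I b \<longleftrightarrow> (\<forall>ips. alternating b I ips \<longrightarrow> ips \<noteq> [] \<longrightarrow> \<phi> (poly_word b ips) = 0)"
  unfolding free_family_def alternating_def poly_word_def case_prod_unfold by blast

lemma alternating_Nil: "alternating b J []"
  by (simp add: alternating_def)

lemma alternating_mono: "alternating b J ips \<Longrightarrow> J \<subseteq> I \<Longrightarrow> alternating b I ips"
  by (auto simp: alternating_def)

lemma alternating_nth_in:
  assumes "alternating b J ips" "ips \<noteq> []"
  shows "fst (hd ips) \<in> J" "fst (last ips) \<in> J"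
  using assms by (auto simp: alternating_def)

lemma alternating_append:
  "alternating b J (ips @ jps) \<longleftrightarrow> alternating b J ips \<and> alternating b J jps \<and>
     (ips = [] \<or> jps = [] \<or> fst (last ips) \<noteq> fst (hd jps))"
  by (auto simp: alternating_def successively_append_iff last_map hd_map)

text \<open>The set \<open>H\<close> restrains the index of the first factor, which must be known
  when another word is put in front.\<close>

abbreviation centered_words :: "('i \<Rightarrow> 'a) \<Rightarrow> 'i set \<Rightarrow> 'i set \<Rightarrow> 'a set" where
  "centered_words b J H \<equiv> {poly_word b ips |ips. alternating b J ips \<and> ips \<noteq> [] \<and> fst (hd ips) \<in> H}"

text \<open>Words are built by appending letters. A polynomial in a new index is centered at the
  cost of a multiple of the shorter word; if the index is that of the last factor, the letter is
  first absorbed into the polynomial of that factor.\<close>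

lemma span_words_alternating:
  assumes "x \<in> span (words b J)"
  shows "x \<in> span (insert 1 (centered_words b J UNIV))"
proof -
  have V: "insert 1 (centered_words b J UNIV) = {poly_word b ips |ips. alternating b J ips}" (is "_ = ?V")
  proof (intro equalityI subsetI)
    fix y assume "y \<in> insert 1 (centered_words b J UNIV)"
    moreover have "1 \<in> ?V" using alternating_Nil poly_word_simps(1) by (metis (mono_tags, lifting) mem_Collect_eq)
    ultimately show "y \<in> ?V" by blast
  next
    fix y assume "y \<in> ?V"
    then obtain ips where "y = poly_word b ips" "alternating b J ips" by blast
    then show "y \<in> insert 1 (centered_words b J UNIV)" by (cases "ips = []") auto
  qed
  have poly: "poly_word b ips * alg_poly smul q (b i) \<in> span ?V"
    if "i \<in> J" "alternating b J ips" "ips = [] \<or> fst (last ips) \<noteq> i" for i ips q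
  proof -
    have "alternating b J (ips @ [(i, centered q (b i))])"
      using that \<phi>_centered by (auto simp: alternating_append) (auto simp: alternating_def)
    then have "poly_word b (ips @ [(i, centered q (b i))]) \<in> span ?V" by (intro span_base) blast
    moreover have "smul (\<phi> (alg_poly smul q (b i))) (poly_word b ips) \<in> span ?V"
      using that by (intro span_scale span_base) blast
    ultimately have "poly_word b (ips @ [(i, centered q (b i))]) +
        smul (\<phi> (alg_poly smul q (b i))) (poly_word b ips) \<in> span ?V" by (rule span_add)
    then show ?thesis
      by (subst alg_poly_centered) (simp add: distrib_left scale_mult_right)
  qed
  have var: "poly_word b ips * b i \<in> span ?V" if i: "i \<in> J" and ips: "alternating b J ips" for i ips
  proof (cases "ips = [] \<or> fst (last ips) \<noteq> i")
    case True
    then show ?thesis using poly[OF i ips, of "monom 1 1"] by (simp add: alg_poly_monom)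
  next
    case False
    then have p: "ips = butlast ips @ [(i, snd (last ips))]" by auto
    then have *: "alternating b J (butlast ips)" "butlast ips = [] \<or> fst (last (butlast ips)) \<noteq> i"
      using ips alternating_append[of b J "butlast ips" "[(i, snd (last ips))]"] p by auto
    have "poly_word b ips * b i = poly_word b (butlast ips) * alg_poly smul (pCons 0 (snd (last ips))) (b i)"
      by (subst p) (simp add: mult.assoc alg_poly_mult_var)
    then show ?thesis using poly[OF i *] by simp
  qed
  have "prod_list (map b is) \<in> span ?V" if "set is \<subseteq> J" for "is"
    using that
  proof (induction "is" rule: rev_induct)
    case Nil
    have "poly_word b [] \<in> ?V"
      by (rule CollectI, rule exI[of _ "[]"]) (simp add: alternating_Nil)
    from span_base[OF this] show ?case by (simp only: poly_word_simps list.map prod_list.Nil)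
  next
    case (snoc i "is")
    have "prod_list (map b is) * b i \<in> span ?V"
    proof (rule span_mult)
      show "prod_list (map b is) \<in> span ?V" using snoc by simp
      show "b i \<in> span {b i}" by (rule span_base) simp
      show "s * t \<in> span ?V" if "s \<in> ?V" "t \<in> {b i}" for s t
        using that var snoc.prems by auto
    qed
    then show ?case by simp
  qed
  then have "words b J \<subseteq> span ?V" by auto
  then have "span (words b J) \<subseteq> span ?V" by (rule span_minimal) simp
  then show ?thesis using assms unfolding V by blast
qed

text \<open>By freeness \<phi> vanishes on nonempty centered words, so the coefficient of 1 in the
  expansion of x is \<open>\<phi> x\<close>.\<close>

lemma span_words_centered:
  assumes "free_family smul \<phi> I b" "J \<subseteq> I" "x \<in> span (words b J)" "\<phi> x = 0"
  shows "x \<in> span (centered_words b J UNIV)"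
proof -
  obtain k where k: "x - smul k 1 \<in> span (centered_words b J UNIV)"
    using span_words_alternating[OF assms(3)] unfolding span_breakdown_eq by blast
  have "\<phi> (poly_word b ips) = 0" if "alternating b J ips" "ips \<noteq> []" for ips
    using that alternating_mono[OF _ assms(2)] assms(1) by (auto simp: free_family_iff)
  then have "\<phi> (x - smul k 1) = \<phi> 0"
    using span_functional_eq[of "centered_words b J UNIV" "\<lambda>x. x" "\<lambda>x. 0", OF _ k]
    by (auto simp: \<phi>_zero)
  then have "k = 0" using assms(4) by (simp add: \<phi>_diff \<phi>_scale functional_one \<phi>_zero)
  then show ?thesis using k by simp
qed

text \<open>At a seam the adjacent indices lie in disjoint blocks and hence differ. Recording the
  block of the first factor carries this through the induction.\<close>

lemma span_centered_words_prod:
  assumes disj: "\<And>s t. s \<noteq> t \<Longrightarrow> J s \<inter> J t = {}" and sub: "\<And>t. J t \<subseteq> I"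
    and "zs \<noteq> []" "successively (\<noteq>) (map fst zs)" "\<forall>(t, x) \<in> set zs. x \<in> span (centered_words b (J t) UNIV)"
  shows "prod_list (map snd zs) \<in> span (centered_words b I (J (fst (hd zs))))"
  using assms(3-5)
proof (induction zs)
  case (Cons z zs)
  obtain t x where z: "z = (t, x)" by (cases z)
  have x: "x \<in> span (centered_words b (J t) UNIV)" using Cons.prems z by auto
  show ?case
  proof (cases "zs = []")
    case True
    have "centered_words b (J t) UNIV \<subseteq> centered_words b I (J t)"
      using alternating_nth_in(1) alternating_mono[OF _ sub] by blast
    then have "span (centered_words b (J t) UNIV) \<subseteq> span (centered_words b I (J t))" by (rule span_mono)
    then show ?thesis using x True z by auto
  next
    case False
    define u where "u = fst (hd zs)"
    have ne: "t \<noteq> u" using Cons.prems False z by (cases zs) (auto simp: u_def)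
    have "prod_list (map snd zs) \<in> span (centered_words b I (J u))"
      unfolding u_def using Cons False by (intro Cons.IH) (auto simp: successively_Cons)
    with x have "x * prod_list (map snd zs) \<in> span (centered_words b I (J t))"
    proof (rule span_mult[rotated])
      fix s y assume "s \<in> centered_words b (J t) UNIV" "y \<in> centered_words b I (J u)"
      then obtain ips jps where ips: "s = poly_word b ips" "alternating b (J t) ips" "ips \<noteq> []"
        and jps: "y = poly_word b jps" "alternating b I jps" "jps \<noteq> []" "fst (hd jps) \<in> J u" by auto
      have "fst (last ips) \<noteq> fst (hd jps)"
        using alternating_nth_in(2)[OF ips(2,3)] jps(4) disj[OF ne] by auto
      then have "alternating b I (ips @ jps)"
        using alternating_mono[OF ips(2) sub] jps(2) ips(3) jps(3) by (simp add: alternating_append)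
      moreover have "fst (hd (ips @ jps)) \<in> J t" using alternating_nth_in(1) ips by simp
      moreover have "s * y = poly_word b (ips @ jps)" using ips jps by simp
      ultimately have "s * y \<in> centered_words b I (J t)" using ips(3) by blast
      then show "s * y \<in> span (centered_words b I (J t))" by (rule span_base)
    qed
    then show ?thesis using z by simp
  qed
qed simp

text \<open>
  Freeness is associative: a centered element of the algebra of one block is a combination of
  alternating centered words in that block, and such words for distinct consecutive blocks
  concatenate to alternating centered words.
\<close>

lemma free_family_blocks:
  assumes free: "free_family smul \<phi> I b"
    and disj: "\<And>s t. s \<noteq> t \<Longrightarrow> J s \<inter> J t = {}" and sub: "\<And>t. J t \<subseteq> I"
    and x: "\<And>t. x t \<in> span (words b (J t))"
  shows "free_family smul \<phi> UNIV x"
  unfolding free_family_iff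
proof (intro allI impI)
  fix tps assume tps: "alternating x UNIV tps" "tps \<noteq> []"
  define zs where "zs = map (\<lambda>(t, p). (t, alg_poly smul p (x t))) tps"
  have "prod_list (map snd zs) \<in> span (centered_words b I (J (fst (hd zs))))"
  proof (rule span_centered_words_prod[OF disj sub])
    show "zs \<noteq> []" "successively (\<noteq>) (map fst zs)"
      using tps by (auto simp: zs_def alternating_def comp_def case_prod_unfold)
    show "\<forall>(t, y) \<in> set zs. y \<in> span (centered_words b (J t) UNIV)"
    proof (intro ballI, clarify)
      fix t y assume "(t, y) \<in> set zs"
      then obtain p where "(t, p) \<in> set tps" "y = alg_poly smul p (x t)" by (auto simp: zs_def)
      then have "y \<in> span (words b (J t))" "\<phi> y = 0"
        using tps by (auto simp: alternating_def intro!: span_words_alg_poly x)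
      then show "y \<in> span (centered_words b (J t) UNIV)"
        by (rule span_words_centered[OF free sub])
    qed
  qed
  then have "\<phi> (prod_list (map snd zs)) = \<phi> 0"
  proof (rule span_functional_eq[where f = "\<lambda>x. x" and g = "\<lambda>_. 0", rotated])
    show "\<phi> s = \<phi> 0" if "s \<in> centered_words b I (J (fst (hd zs)))" for s
      using that free by (auto simp: free_family_iff \<phi>_zero)
  qed simp_all
  moreover have "prod_list (map snd zs) = poly_word x tps"
    by (simp add: zs_def poly_word_def comp_def case_prod_unfold)
  ultimately show "\<phi> (poly_word x tps) = 0" by (simp add: \<phi>_zero)
qed

section \<open>Bounds for mixed moments of free variables\<close>

definition power_word :: "('t \<Rightarrow> 'a) \<Rightarrow> ('t \<times> nat) list \<Rightarrow> 'a" where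
  "power_word x zs = prod_list (map (\<lambda>(t, j). x t ^ j) zs)"

definition centered_power_word :: "('t \<Rightarrow> 'a) \<Rightarrow> ('t \<times> nat) list \<Rightarrow> 'a" where
  "centered_power_word x zs = prod_list (map (\<lambda>(t, j). x t ^ j - smul (\<phi> (x t ^ j)) 1) zs)"

text \<open>A budget of exponents: it is unchanged when equal neighbours merge and does not grow
  when a factor is dropped, so moments up to a fixed order suffice throughout.\<close>

definition letter_degree :: "'t \<Rightarrow> ('t \<times> nat) list \<Rightarrow> nat" where
  "letter_degree t zs = sum_list (map (\<lambda>(s, j). if s = t then j else 0) zs)"

text \<open>Replaces the letters by their centered versions one at a time, starting from the left.\<close>

lemma centered_power_word_bound:
  assumes "K \<ge> 0" "B \<ge> 0" and K: "\<And>t j. j \<le> d t \<Longrightarrow> cmod (\<phi> (x t ^ j)) \<le> K"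
    and B: "\<And>zs. length zs \<le> r \<Longrightarrow> (\<And>t. letter_degree t zs \<le> d t) \<Longrightarrow> cmod (\<phi> (power_word x zs)) \<le> B"
    and "length us + length vs \<le> Suc r" "\<And>t. letter_degree t (us @ vs) \<le> d t"
  shows "cmod (\<phi> (centered_power_word x us * power_word x vs) - \<phi> (power_word x us * power_word x vs))
    \<le> ((1 + K) ^ length us - 1) * B"
  using assms(5,6)
proof (induction us arbitrary: vs rule: rev_induct)
  case Nil
  then show ?case by (simp add: centered_power_word_def power_word_def)
next
  case (snoc u us)
  obtain t j where u: "u = (t, j)" by (cases u)
  let ?l = "length us" and ?m = "\<phi> (x t ^ j)"
  let ?A = "\<phi> (centered_power_word x us * power_word x ((t, j) # vs))"
  let ?A' = "\<phi> (power_word x us * power_word x ((t, j) # vs))"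
  let ?D = "\<phi> (centered_power_word x us * power_word x vs)"
  let ?D' = "\<phi> (power_word x us * power_word x vs)"
  have deg: "letter_degree s (us @ vs) \<le> d s" for s
    using snoc.prems(2)[of s] by (simp add: letter_degree_def)
  have "j \<le> d t" using snoc.prems(2)[of t] by (simp add: letter_degree_def u)
  then have m: "cmod ?m \<le> K" by (rule K)
  have "centered_power_word x (us @ [u]) * power_word x vs =
      centered_power_word x us * power_word x ((t, j) # vs) - smul ?m (centered_power_word x us * power_word x vs)"
  proof -
    have "centered_power_word x (us @ [u]) = centered_power_word x us * (x t ^ j - smul ?m 1)"
      "power_word x ((t, j) # vs) = x t ^ j * power_word x vs"
      by (simp_all add: u centered_power_word_def power_word_def)
    then show ?thesis
      by (simp only: mult.assoc left_diff_distrib right_diff_distrib scale_mult_left scale_mult_right mult_1)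
  qed
  then have eq: "\<phi> (centered_power_word x (us @ [u]) * power_word x vs) = ?A - ?m * ?D"
    by (simp add: \<phi>_diff \<phi>_scale)
  have A: "cmod (?A - ?A') \<le> ((1 + K) ^ ?l - 1) * B"
    using snoc.prems by (intro snoc.IH) (simp_all add: u)
  have "cmod (?D - ?D') \<le> ((1 + K) ^ ?l - 1) * B"
    using snoc.prems deg by (intro snoc.IH) simp_all
  \<comment> \<open>The letter \<open>u\<close> has been dropped here, so the word is short enough
    for the bound \<open>B\<close>.\<close>
  moreover have "cmod ?D' \<le> B"
    using snoc.prems(1) deg B[of "us @ vs"] by (simp add: power_word_def)
  ultimately have "cmod ?D \<le> (1 + K) ^ ?l * B"
  proof -
    have "((1 + K) ^ ?l - 1) * B = (1 + K) ^ ?l * B - B" by (simp add: left_diff_distrib)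
    moreover assume "cmod (?D - ?D') \<le> ((1 + K) ^ ?l - 1) * B" "cmod ?D' \<le> B"
    ultimately show ?thesis using norm_triangle_sub[of ?D ?D'] by linarith
  qed
  then have "cmod ?m * cmod ?D \<le> K * ((1 + K) ^ ?l * B)"
     by (rule mult_mono[OF m _ assms(1) norm_ge_zero])
  moreover have eq': "\<phi> (power_word x (us @ [u]) * power_word x vs) = ?A'"
    by (simp add: u power_word_def mult.assoc)
  moreover have "cmod (?A - ?m * ?D - ?A') \<le> cmod (?A - ?A') + cmod ?m * cmod ?D"
    using norm_triangle_ineq4[of "?A - ?A'" "?m * ?D"] by (simp only: norm_mult cancel_ab_semigroup_add_class.diff_right_commute[of ?A ?A'])
  \<comment> \<open>The constant solves c(l + 1) = c(l) + K (c(l) + 1) with c(0) = 0.\<close>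
  moreover have "((1 + K) ^ ?l - 1) * B + K * ((1 + K) ^ ?l * B) = ((1 + K) ^ length (us @ [u]) - 1) * B"
    by (simp add: algebra_simps)
  ultimately show ?case
    using A unfolding eq eq' by linarith
qed

text \<open>Induction on the number of factors. Equal neighbours merge into one power. Otherwise the
  product of the centered powers has expectation 0 by freeness, so the moment equals its difference
  from that product, which is controlled by shorter words. The exponent works because r^2 + r + 1
  \<le> (r + 1)^2.\<close>

lemma free_power_word_bound:
  assumes free: "free_family smul \<phi> UNIV x" and "K \<ge> 0"
    and K: "\<And>t j. j \<le> d t \<Longrightarrow> cmod (\<phi> (x t ^ j)) \<le> K"
    and "length zs \<le> r" "\<And>t. letter_degree t zs \<le> d t"
  shows "cmod (\<phi> (power_word x zs)) \<le> (1 + K) ^ (r * r)"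
  using assms(4,5)
proof (induction r arbitrary: zs)
  case 0
  then show ?case by (simp add: power_word_def functional_one)
next
  case (Suc r)
  define B where "B = (1 + K) ^ (r * r)"
  have B: "B \<ge> 0" using \<open>K \<ge> 0\<close> by (simp add: B_def)
  have "B * (1 + K) ^ Suc r = (1 + K) ^ (r * r + Suc r)" by (simp only: B_def power_add)
  also have "\<dots> \<le> (1 + K) ^ (Suc r * Suc r)" using \<open>K \<ge> 0\<close> by (intro power_increasing) auto
  finally have step: "B * (1 + K) ^ Suc r \<le> (1 + K) ^ (Suc r * Suc r)" .
  have "B * 1 \<le> B * (1 + K) ^ Suc r" using B \<open>K \<ge> 0\<close> by (intro mult_left_mono one_le_power) auto
  then have B_le: "B \<le> (1 + K) ^ (Suc r * Suc r)" using step by linarith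
  show ?case
  proof (cases "successively (\<noteq>) (map fst zs)")
    case False
    have "\<exists>us t i j vs. zs = us @ (t, i) # (t, j) # vs"
      using False
    proof (induction zs)
      case (Cons z zs)
      show ?case
      proof (cases "successively (\<noteq>) (map fst zs)")
        case True
        then obtain z' zs' where "zs = z' # zs'" "fst z = fst z'"
          using Cons.prems by (cases zs) auto
        then show ?thesis by (metis append_Nil prod.collapse)
      next
        case False
        then show ?thesis using Cons.IH by (metis append_Cons)
      qed
    qed simp
    then obtain us t i j vs where zs: "zs = us @ (t, i) # (t, j) # vs" by blast
    have "letter_degree s (us @ (t, i + j) # vs) \<le> d s" for s
      using Suc.prems(2)[of s] by (auto simp: zs letter_degree_def split: if_splits)
    then have "cmod (\<phi> (power_word x (us @ (t, i + j) # vs))) \<le> B"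
      unfolding B_def using Suc.prems(1) by (intro Suc.IH) (simp_all add: zs)
    moreover have "power_word x (us @ (t, i + j) # vs) = power_word x zs"
      by (simp add: zs power_word_def power_add mult.assoc)
    ultimately show ?thesis using B_le by simp
  next
    case True
    show ?thesis
    proof (cases "zs = []")
      case True
      then show ?thesis
        using one_le_power[of "1 + K" "Suc r * Suc r"] \<open>K \<ge> 0\<close>
        by (simp add: power_word_def functional_one del: power_Suc mult_Suc mult_Suc_right)
    next
      case False
      define tps where "tps = map (\<lambda>(t, j). (t, centered (monom 1 j) (x t))) zs"
      have "alternating x UNIV tps" "tps \<noteq> []"
        using True False by (auto simp: tps_def alternating_def \<phi>_centered comp_def case_prod_unfold)
      then have "\<phi> (poly_word x tps) = 0" using free by (simp add: free_family_iff)
      moreover have "poly_word x tps = centered_power_word x zs"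
        by (simp add: tps_def poly_word_def centered_power_word_def comp_def case_prod_unfold
            centered_def alg_poly_diff_const alg_poly_monom)
      moreover have "cmod (\<phi> (centered_power_word x zs * power_word x []) -
          \<phi> (power_word x zs * power_word x [])) \<le> ((1 + K) ^ length zs - 1) * B"
        by (rule centered_power_word_bound[OF \<open>K \<ge> 0\<close> B K _, where r = r])
          (use Suc in \<open>auto simp: B_def\<close>)
      ultimately have "cmod (\<phi> (power_word x zs)) \<le> ((1 + K) ^ length zs - 1) * B"
        by (simp add: power_word_def)
      also have "\<dots> \<le> (1 + K) ^ Suc r * B"
      proof (intro mult_right_mono B)
        have "(1 + K) ^ length zs \<le> (1 + K) ^ Suc r"
          using Suc.prems(1) \<open>K \<ge> 0\<close> by (intro power_increasing) auto
        then show "(1 + K) ^ length zs - 1 \<le> (1 + K) ^ Suc r" by linarith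
      qed
      finally show ?thesis using step by (simp add: mult.commute)
    qed
  qed
qed

lemma word2_scale: "word2 (smul c x) y ts = smul (c ^ count_list ts False) (word2 x y ts)"
  by (induction ts) (simp_all add: scale_mult_left scale_mult_right mult.commute)

lemma free_word2_bound:
  assumes "free_family smul \<phi> UNIV (\<lambda>t. if t then y else x)" "K \<ge> 0"
    and "\<And>j. j \<le> count_list ts False \<Longrightarrow> cmod (\<phi> (x ^ j)) \<le> K"
    and "\<And>j. j \<le> count_list ts True \<Longrightarrow> cmod (\<phi> (y ^ j)) \<le> K"
  shows "cmod (\<phi> (word2 x y ts)) \<le> (1 + K) ^ (length ts * length ts)"
proof -
  define zs where "zs = map (\<lambda>t. (t, 1 :: nat)) ts"
  have "letter_degree t zs = count_list ts t" for t
    unfolding zs_def letter_degree_def by (induction ts) auto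
  then have "cmod (\<phi> (power_word (\<lambda>t. if t then y else x) zs)) \<le> (1 + K) ^ (length ts * length ts)"
    using assms(2-4) by (intro free_power_word_bound[OF assms(1), where d = "count_list ts"])
      (auto simp: zs_def)
  then show ?thesis by (simp add: zs_def power_word_def word2_def comp_def)
qed

end

section \<open>Independent and half-independent families\<close>

text \<open>Occurrences at even minus occurrences at odd positions, counted from 0; the recursion
  subtracts because a letter put in front exchanges the parities.\<close>

primrec parity_balance :: "'i \<Rightarrow> 'i list \<Rightarrow> int" where
  "parity_balance i [] = 0"
| "parity_balance i (j # js) = (if j = i then 1 else 0) - parity_balance i js"

lemma parity_balance_eq_card:
  "parity_balance i js = int (card {p. p < length js \<and> even p \<and> js ! p = i})
     - int (card {p. p < length js \<and> odd p \<and> js ! p = i})"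
proof (induction js)
  case (Cons j js)
  let ?E = "\<lambda>js. {p. p < length js \<and> even p \<and> js ! p = i}"
  let ?O = "\<lambda>js. {p. p < length js \<and> odd p \<and> js ! p = i}"
  have "p \<in> ?O (j # js) \<longleftrightarrow> p \<in> Suc ` ?E js" for p
    by (cases p) auto
  then have O: "?O (j # js) = Suc ` ?E js" by blast
  have "p \<in> ?E (j # js) \<longleftrightarrow> p \<in> (if j = i then {0} else {}) \<union> Suc ` ?O js" for p
    by (cases p) auto
  then have E: "?E (j # js) = (if j = i then {0} else {}) \<union> Suc ` ?O js" by blast
  have "card (?E (j # js)) = (if j = i then 1 else 0) + card (?O js)"
    unfolding E by (subst card_Un_disjoint) (auto simp: card_image)
  then show ?case
    using Cons unfolding O by (simp add: card_image)
qed simp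

lemma symmetric_monomial_iff: "symmetric_monomial js \<longleftrightarrow> (\<forall>i. parity_balance i js = 0)"
  unfolding symmetric_monomial_def parity_balance_eq_card by force

lemma parity_balance_append:
  "parity_balance i (xs @ ys) = parity_balance i xs + (- 1) ^ length xs * parity_balance i ys"
  by (induction xs) auto

lemma parity_balance_notin: "i \<notin> set xs \<Longrightarrow> parity_balance i xs = 0"
  by (induction xs) auto

lemma parity_balance_replicate:
  "parity_balance i (replicate k j) = (if i = j \<and> odd k then 1 else 0)"
  by (induction k) auto

lemma even_parity_balance: "even (parity_balance i xs) \<longleftrightarrow> even (count_list xs i)"
  by (induction xs) auto

lemma parity_balance_bool:
  "parity_balance True ts + parity_balance False ts = (if even (length ts) then 0 else 1)"
  by (induction ts) auto

text \<open>A surplus at positions of one parity forces an occurrence there. Both signs are proved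
  together, since a letter put in front exchanges them.\<close>

lemma parity_balance_split:
  "(parity_balance i ys > 0 \<longrightarrow> (\<exists>v w. ys = v @ i # w \<and> even (length v))) \<and>
   (parity_balance i ys < 0 \<longrightarrow> (\<exists>v w. ys = v @ i # w \<and> odd (length v)))"
proof (induction ys)
  case (Cons j ys)
  have "\<exists>v w. j # ys = v @ i # w \<and> even (length v)" if "parity_balance i (j # ys) > 0"
  proof (cases "j = i")
    case True
    then show ?thesis by (intro exI[of _ "[]"] exI[of _ ys]) simp
  next
    case False
    then have "parity_balance i ys < 0" using that by simp
    then obtain v w where "ys = v @ i # w" "odd (length v)" using Cons by blast
    then show ?thesis by (intro exI[of _ "j # v"] exI[of _ w]) simp
  qed
  moreover have "\<exists>v w. j # ys = v @ i # w \<and> odd (length v)" if "parity_balance i (j # ys) < 0"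
  proof -
    have "parity_balance i ys > 0" using that by (auto split: if_splits)
    then obtain v w where "ys = v @ i # w" "even (length v)" using Cons by auto
    then show ?thesis by (intro exI[of _ "j # v"] exI[of _ w]) simp
  qed
  ultimately show ?case by blast
qed simp

section \<open>Normal forms of commuting and half-commuting words\<close>

lemma prod_list_powers_Suc:
  fixes g :: "'i \<Rightarrow> 'a::monoid_mult"
  assumes "\<And>j. j \<in> set js \<Longrightarrow> g i * g j = g j * g i" "distinct js" "i \<in> set js"
  shows "g i * prod_list (map (\<lambda>j. g j ^ k j) js) = prod_list (map (\<lambda>j. g j ^ (k(i := Suc (k i))) j) js)"
  using assms
proof (induction js)
  case (Cons j js)
  show ?case
  proof (cases "j = i")
    case True
    then have eq: "map (\<lambda>j. g j ^ (k(i := Suc (k i))) j) js = map (\<lambda>j. g j ^ k j) js"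
      using Cons.prems by (intro map_cong) auto
    show ?thesis
      by (simp only: True list.map(2) prod_list.Cons eq fun_upd_same power_Suc mult.assoc)
  next
    case False
    have "g i * g j ^ k j = g j ^ k j * g i"
      using power_commuting_commutes[of "g j" "g i" "k j"] Cons.prems(1)[of j] by simp
    moreover have "g i * prod_list (map (\<lambda>j. g j ^ k j) js) =
        prod_list (map (\<lambda>j. g j ^ (k(i := Suc (k i))) j) js)"
      using Cons False by (intro Cons.IH) auto
    ultimately show ?thesis
      using False by (simp del: fun_upd_apply add: mult.assoc[symmetric]) (simp add: mult.assoc)
  qed
qed simp

lemma prod_list_ones: "prod_list (map (\<lambda>_. 1) js) = (1 :: 'a::monoid_mult)"
  by (induction js) auto

lemma commuting_word:
  fixes b :: "'i \<Rightarrow> 'a::monoid_mult"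
  assumes "\<And>i j. i \<in> set js \<Longrightarrow> j \<in> set js \<Longrightarrow> b i * b j = b j * b i" "distinct js" "set is \<subseteq> set js"
  shows "prod_list (map b is) = prod_list (map (\<lambda>i. b i ^ count_list is i) js)"
  using assms(3)
proof (induction "is")
  case Nil
  then show ?case by (simp add: prod_list_ones)
next
  case (Cons i "is")
  have "prod_list (map b (i # is)) = b i * prod_list (map (\<lambda>j. b j ^ count_list is j) js)"
    using Cons by simp
  also have "\<dots> = prod_list (map (\<lambda>j. b j ^ ((count_list is)(i := Suc (count_list is i))) j) js)"
    using assms Cons.prems by (intro prod_list_powers_Suc) auto
  also have "(count_list is)(i := Suc (count_list is i)) = count_list (i # is)"
    by auto
  finally show ?case .
qed

lemma half_commutingD:
  assumes "half_commuting I g" "i \<in> I" "j \<in> I" "k \<in> I"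
  shows "g i * (g j * g k) = g k * (g j * g i)"
  using assms unfolding half_commuting_def by (simp add: mult.assoc)

text \<open>Half-commutation with two adjacent equal letters i makes the square of
  \<open>g i\<close> commute with every letter.\<close>

lemma half_commuting_square_word:
  assumes "half_commuting I g" "i \<in> I" "set v \<subseteq> I"
  shows "g i ^ 2 * prod_list (map g v) = prod_list (map g v) * g i ^ 2"
  using assms(3)
proof (induction v)
  case (Cons j v)
  have "g i ^ 2 * g j = g j * g i ^ 2"
    using half_commutingD[OF assms(1), of i i j] assms(2) Cons.prems
    by (simp add: power2_eq_square mult.assoc)
  then show ?case
    using Cons by (simp add: mult.assoc[symmetric]) (simp add: mult.assoc)
qed simp

text \<open>The relation i x y = y x i carries i past two letters and exchanges them. Each letter of
  \<open>v\<close> thus changes the parity of its position, whence the sign of the balance.\<close>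

lemma half_commuting_conjugate:
  assumes "half_commuting I g" "i \<in> I" "set v \<subseteq> I" "even (length v)"
  obtains u where "set u \<subseteq> I" "\<And>j. parity_balance j u = - parity_balance j v"
    "\<And>j. count_list u j = count_list v j" "length u = length v"
    "g i * prod_list (map g v) * g i = prod_list (map g u) * g i ^ 2"
proof -
  have "\<exists>u. set u \<subseteq> I \<and> (\<forall>j. parity_balance j u = - parity_balance j v) \<and>
    (\<forall>j. count_list u j = count_list v j) \<and> length u = length v \<and>
    g i * prod_list (map g v) * g i = prod_list (map g u) * g i ^ 2"
    using assms(3,4)
  proof (induction v rule: induct_list012)
    case 1
    then show ?case by (intro exI[of _ "[]"]) (simp add: power2_eq_square)
  next
    case (3 x y v)
    then obtain u where u: "set u \<subseteq> I" "\<forall>j. parity_balance j u = - parity_balance j v"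
      "\<forall>j. count_list u j = count_list v j" "length u = length v"
      "g i * prod_list (map g v) * g i = prod_list (map g u) * g i ^ 2"
      by auto
    have "g i * prod_list (map g (x # y # v)) * g i = g i * (g x * g y) * prod_list (map g v) * g i"
      by (simp add: mult.assoc)
    also have "g i * (g x * g y) = g y * (g x * g i)"
      using 3 assms by (intro half_commutingD[OF assms(1)]) auto
    also have "g y * (g x * g i) * prod_list (map g v) * g i =
        g y * g x * (g i * prod_list (map g v) * g i)"
      by (simp add: mult.assoc)
    also have "\<dots> = prod_list (map g (y # x # u)) * g i ^ 2"
      unfolding u(5) by (simp add: mult.assoc)
    finally show ?case
      using u(1-4) 3 by (intro exI[of _ "y # x # u"]) auto
  qed simp
  then show thesis using that by blast
qed

text \<open>
  If the first letter \<open>i\<close> of a symmetric word occurs again after an even number of letters, then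
  swapping these letters pairwise turns \<open>i v i\<close> into \<open>v' i i\<close>, where \<open>i i\<close> is central.
\<close>

lemma half_commuting_symmetric_word:
  assumes "half_commuting I g" "symmetric_monomial xs" "distinct js" "set xs \<subseteq> set js" "set js \<subseteq> I"
  shows "prod_list (map g xs) = prod_list (map (\<lambda>i. (g i ^ 2) ^ (count_list xs i div 2)) js)"
  using assms(2,4)
proof (induction xs rule: length_induct)
  case (1 xs)
  show ?case
  proof (cases xs)
    case Nil
    then show ?thesis by (simp add: prod_list_ones)
  next
    case (Cons i ys)
    have bal: "parity_balance j xs = 0" for j
      using 1 by (simp add: symmetric_monomial_iff)
    \<comment> \<open>The first letter contributes 1 to the balance of \<open>xs\<close>, which is
      0, and \<open>ys\<close> enters with a minus sign.\<close>
    have "parity_balance i ys > 0" using bal[of i] Cons by simp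
    then obtain v w where ys: "ys = v @ i # w" and v: "even (length v)"
      using parity_balance_split[of i ys] by blast
    have I: "i \<in> I" "set v \<subseteq> I" "set w \<subseteq> I" "i \<in> set js"
      using 1 assms(5) by (auto simp: Cons ys)
    obtain u where u: "set u \<subseteq> I" "\<And>j. parity_balance j u = - parity_balance j v"
      "\<And>j. count_list u j = count_list v j" "length u = length v"
      "g i * prod_list (map g v) * g i = prod_list (map g u) * g i ^ 2"
      using half_commuting_conjugate[OF assms(1) I(1,2) v] by blast
    let ?zs = "u @ w"
    let ?k = "\<lambda>j. count_list ?zs j div 2"
    have "set u = set v" using u(3) by (metis count_list_0_iff subsetI subset_antisym)
    then have sub: "set ?zs \<subseteq> set js" using 1 by (auto simp: Cons ys)
    \<comment> \<open>The two removed letters i stand at positions of opposite parity and cancel.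
      What \<open>v\<close> contributes to the balance of \<open>xs\<close> is minus its own
      balance, and this is the balance of \<open>u\<close>.\<close>
    have sym: "symmetric_monomial ?zs"
      unfolding symmetric_monomial_iff
    proof
      fix j
      show "parity_balance j ?zs = 0"
        using bal[of j] v u(2)[of j] u(4)
        by (auto simp: Cons ys parity_balance_append split: if_splits)
    qed
    have "length ?zs < length xs" using u(4) by (simp add: Cons ys)
    then have IH: "prod_list (map g ?zs) = prod_list (map (\<lambda>i. (g i ^ 2) ^ ?k i) js)"
      using 1 sub sym by blast
    have "prod_list (map g xs) = g i * prod_list (map g v) * g i * prod_list (map g w)"
      by (simp add: Cons ys mult.assoc)
    also have "\<dots> = prod_list (map g u) * g i ^ 2 * prod_list (map g w)" by (simp only: u(5))
    also have "\<dots> = g i ^ 2 * prod_list (map g ?zs)"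
      using half_commuting_square_word[OF assms(1) I(1) u(1)]
      by (simp only: map_append prod_list.append mult.assoc[symmetric])
    also have "\<dots> = prod_list (map (\<lambda>j. (g j ^ 2) ^ (?k(i := Suc (?k i))) j) js)"
      unfolding IH
    proof (rule prod_list_powers_Suc[OF _ assms(3) I(4)])
      fix j assume "j \<in> set js"
      then have "set [j, j] \<subseteq> I" using assms(5) by auto
      from half_commuting_square_word[OF assms(1) I(1) this]
      show "g i ^ 2 * g j ^ 2 = g j ^ 2 * g i ^ 2" by (simp add: power2_eq_square)
    qed
    also have "?k(i := Suc (?k i)) = (\<lambda>j. count_list xs j div 2)"
      using u(3) by (auto simp: Cons ys)
    finally show ?thesis .
  qed
qed

section \<open>Factorization of mixed moments\<close>

context nc_prob_space
begin

text \<open>By linearity it suffices to treat words. Collected into powers of distinct variables, a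
  word over J takes \<open>b n ^ q\<close> as one more factor.\<close>

lemma independent_mult_power:
  assumes ind: "independent_family \<phi> I b" and "J \<subseteq> I" "n \<in> I" "n \<notin> J" and x: "x \<in> span (words b J)"
  shows "\<phi> (x * b n ^ q) = \<phi> x * \<phi> (b n ^ q)"
proof -
  have "\<phi> (x * b n ^ q) = \<phi> (smul (\<phi> (b n ^ q)) x)"
  proof (rule span_functional_eq[OF _ x])
    fix s assume "s \<in> words b J"
    then obtain "is" where s: "s = prod_list (map b is)" "set is \<subseteq> J" by auto
    define js where "js = remdups is"
    define k where "k = (count_list is)(n := q)"
    have js: "distinct js" "set js = set is" by (auto simp: js_def)
    have n: "n \<notin> set js" using js s assms(4) by auto
    have prod: "\<phi> (prod_list (map (\<lambda>i. b i ^ k i) ls)) = (\<Prod>i\<in>set ls. \<phi> (b i ^ k i))"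
      if "distinct ls" "set ls \<subseteq> I" for ls
      using ind that unfolding independent_family_def by blast
    have "prod_list (map b is) = prod_list (map (\<lambda>i. b i ^ count_list is i) js)"
    proof (rule commuting_word)
      have "set js \<subseteq> I" using js s assms(2) by auto
      then show "b i * b j = b j * b i" if "i \<in> set js" "j \<in> set js" for i j
        using ind that unfolding independent_family_def by blast
    qed (use js in auto)
    also have "map (\<lambda>i. b i ^ count_list is i) js = map (\<lambda>i. b i ^ k i) js"
      using n by (auto simp: k_def)
    finally have word: "s = prod_list (map (\<lambda>i. b i ^ k i) js)" by (simp add: s)
    then have "s * b n ^ q = prod_list (map (\<lambda>i. b i ^ k i) (js @ [n]))" by (simp add: k_def)
    then have "\<phi> (s * b n ^ q) = (\<Prod>i\<in>set (js @ [n]). \<phi> (b i ^ k i))"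
      using prod[of "js @ [n]"] js s n assms(2,3) by auto
    also have "\<dots> = \<phi> (b n ^ q) * (\<Prod>i\<in>set js. \<phi> (b i ^ k i))"
      using n by (simp add: k_def)
    also have "(\<Prod>i\<in>set js. \<phi> (b i ^ k i)) = \<phi> s"
      unfolding word using prod[of js] js s assms(2) by auto
    finally show "\<phi> (s * b n ^ q) = \<phi> (smul (\<phi> (b n ^ q)) s)" by (simp add: \<phi>_scale)
  qed (simp_all add: distrib_right scale_mult_left scale_right_distrib mult.commute)
  then show ?thesis by (simp add: \<phi>_scale mult.commute)
qed

text \<open>A symmetric word is a product of powers of independent squares, and the even power of
  \<open>b n\<close> adds one more. A nonsymmetric word has an unbalanced index, which differs from
  n and stays unbalanced, so both sides vanish.\<close>

lemma half_independent_mult_power: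
  assumes half: "half_independent_family \<phi> I b" and "J \<subseteq> I" "n \<in> I" "n \<notin> J" and x: "x \<in> span (words b J)"
    and "even q"
  shows "\<phi> (x * b n ^ q) = \<phi> x * \<phi> (b n ^ q)"
proof -
  obtain r where r: "q = 2 * r" using \<open>even q\<close> by auto
  have "\<phi> (x * b n ^ q) = \<phi> (smul (\<phi> (b n ^ q)) x)"
  proof (rule span_functional_eq[OF _ x])
    fix s assume "s \<in> words b J"
    then obtain "is" where s: "s = prod_list (map b is)" "set is \<subseteq> J" by auto
    show "\<phi> (s * b n ^ q) = \<phi> (smul (\<phi> (b n ^ q)) s)"
    proof (cases "symmetric_monomial is")
      case True
      define js where "js = remdups is"
      define k where "k = (\<lambda>i. count_list is i div 2)(n := r)"
      have js: "distinct js" "set js = set is" by (auto simp: js_def)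
      have n: "n \<notin> set js" using js s assms(4) by auto
      have prod: "\<phi> (prod_list (map (\<lambda>i. (b i ^ 2) ^ k i) ls)) = (\<Prod>i\<in>set ls. \<phi> ((b i ^ 2) ^ k i))"
        if "distinct ls" "set ls \<subseteq> I" for ls
        using half that unfolding independent_family_def half_independent_family_def by blast
      have "s = prod_list (map (\<lambda>i. (b i ^ 2) ^ (count_list is i div 2)) js)"
        unfolding s using half js s assms(2) True
        by (intro half_commuting_symmetric_word[where I = I]) (auto simp: half_independent_family_def)
      also have "map (\<lambda>i. (b i ^ 2) ^ (count_list is i div 2)) js = map (\<lambda>i. (b i ^ 2) ^ k i) js"
        using n by (auto simp: k_def)
      finally have word: "s = prod_list (map (\<lambda>i. (b i ^ 2) ^ k i) js)" .
      have bn: "b n ^ q = (b n ^ 2) ^ k n" by (simp add: k_def r power_mult)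
      then have "s * b n ^ q = prod_list (map (\<lambda>i. (b i ^ 2) ^ k i) (js @ [n]))" by (simp add: word)
      then have "\<phi> (s * b n ^ q) = (\<Prod>i\<in>set (js @ [n]). \<phi> ((b i ^ 2) ^ k i))"
        using prod[of "js @ [n]"] js s n assms(2,3) by auto
      also have "\<dots> = \<phi> (b n ^ q) * (\<Prod>i\<in>set js. \<phi> ((b i ^ 2) ^ k i))"
        using n by (simp add: bn)
      also have "(\<Prod>i\<in>set js. \<phi> ((b i ^ 2) ^ k i)) = \<phi> s"
        unfolding word using prod[of js] js s assms(2) by auto
      finally show ?thesis by (simp add: \<phi>_scale)
    next
      case False
      then obtain i where i: "parity_balance i is \<noteq> 0" by (auto simp: symmetric_monomial_iff)
      then have "i \<noteq> n" using s assms(4) parity_balance_notin by fastforce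
      then have "parity_balance i (is @ replicate q n) \<noteq> 0"
        using i by (simp add: parity_balance_append parity_balance_replicate)
      then have "\<not> symmetric_monomial (is @ replicate q n)" by (auto simp: symmetric_monomial_iff)
      moreover have "s * b n ^ q = prod_list (map b (is @ replicate q n))"
        by (simp add: s)
      ultimately have "\<phi> (s * b n ^ q) = 0"
      proof -
        have "set (is @ replicate q n) \<subseteq> I" using s assms(2,3) by auto
        moreover assume "\<not> symmetric_monomial (is @ replicate q n)"
          "s * b n ^ q = prod_list (map b (is @ replicate q n))"
        ultimately show ?thesis using half unfolding half_independent_family_def by metis
      qed
      moreover have "\<phi> s = 0"
        using half s assms(2) False unfolding half_independent_family_def by auto
      ultimately show ?thesis by (simp add: \<phi>_scale)
    qed
  qed (simp_all add: distrib_right scale_mult_left scale_right_distrib mult.commute)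
  then show ?thesis by (simp add: \<phi>_scale mult.commute)
qed

lemma word2_commuting:
  assumes "x * y = y * x"
  shows "word2 x y ts = x ^ count_list ts False * y ^ count_list ts True"
proof (induction ts)
  case (Cons t ts)
  have "y * x ^ k = x ^ k * y" for k
    using power_commuting_commutes[OF assms] by simp
  then show ?case
    using Cons by (simp add: mult.assoc[symmetric])
qed simp

text \<open>The relation is linear in each of the three arguments and passes to spans one argument
  at a time. On the unital algebra y = 1 would force commutation, so the linear span of the
  variables takes the place of the span of words.\<close>

lemma half_commuting_span:
  assumes half: "half_commuting I b" and "x \<in> span (b ` I)" "y \<in> span (b ` I)" "z \<in> span (b ` I)"
  shows "x * y * z = z * y * x"
proof -
  have 1: "x * b j * b k = b k * b j * x" if "j \<in> I" "k \<in> I" for j k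
    using assms(2)
  proof (rule span_induct)
    show "subspace {x. x * b j * b k = b k * b j * x}"
      by (rule subspaceI) (simp_all add: distrib_left distrib_right scale_mult_left scale_mult_right)
  qed (use half that in \<open>auto simp: half_commuting_def\<close>)
  have 2: "x * y * b k = b k * y * x" if "k \<in> I" for k
    using assms(3)
  proof (rule span_induct)
    show "subspace {y. x * y * b k = b k * y * x}"
      by (rule subspaceI) (simp_all add: distrib_left distrib_right scale_mult_left scale_mult_right)
  qed (use 1 that in auto)
  show ?thesis
    using assms(4)
  proof (rule span_induct)
    show "subspace {z. x * y * z = z * y * x}"
      by (rule subspaceI) (simp_all add: distrib_left distrib_right scale_mult_left scale_mult_right)
  qed (use 2 in auto)
qed

text \<open>Multiplying out x keeps the pattern of the word: \<open>list_all2\<close> records which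
  positions come from \<open>b n\<close> and which from x.\<close>

lemma word2_span:
  assumes x: "x \<in> span (b ` J)"
  shows "word2 x (b n) ts \<in> span {prod_list (map b is) |is. list_all2 (\<lambda>t i. if t then i = n else i \<in> J) ts is}"
proof (induction ts)
  case Nil
  show ?case by (rule span_base) (auto intro!: exI[of _ "[]"])
next
  case (Cons t ts)
  have "(if t then b n else x) \<in> span (b ` (if t then {n} else J))"
    using x by (auto intro: span_base)
  from this Cons have "(if t then b n else x) * word2 x (b n) ts
      \<in> span {prod_list (map b is) |is. list_all2 (\<lambda>t i. if t then i = n else i \<in> J) (t # ts) is}"
  proof (rule span_mult[rotated])
    fix s u assume "s \<in> b ` (if t then {n} else J)"
      "u \<in> {prod_list (map b is) |is. list_all2 (\<lambda>t i. if t then i = n else i \<in> J) ts is}"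
    then obtain i "is" where i: "s = b i" "if t then i = n else i \<in> J" "u = prod_list (map b is)"
        "list_all2 (\<lambda>t i. if t then i = n else i \<in> J) ts is"
      by (cases t) auto
    then have "s * u = prod_list (map b (i # is))"
      "list_all2 (\<lambda>t i. if t then i = n else i \<in> J) (t # ts) (i # is)" by auto
    then show "s * u \<in> span {prod_list (map b is) |is. list_all2 (\<lambda>t i. if t then i = n else i \<in> J) (t # ts) is}"
      by (intro span_base CollectI exI conjI)
  qed
  then show ?case by simp
qed

text \<open>The letters from J occupy exactly the positions marked \<open>False\<close>, so their
  balances add up to that of \<open>False\<close>. Hence a symmetric word arises only from a
  symmetric pattern.\<close>

lemma parity_balance_expansion:
  assumes "list_all2 (\<lambda>t i. if t then i = n else i \<in> J) ts is" "n \<notin> J" "finite J"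
  shows "parity_balance n is = parity_balance True ts"
    "(\<Sum>i\<in>J. parity_balance i is) = parity_balance False ts"
    "set is \<subseteq> insert n J"
  using assms(1)
proof (induction rule: list_all2_induct)
  case (Cons t ts i "is")
  {
    case 1 then show ?case using Cons assms(2) by (auto split: if_splits)
  next
    case 2
    have "(\<Sum>j\<in>J. parity_balance j (i # is)) = (\<Sum>j\<in>J. if i = j then 1 else 0) - parity_balance False ts"
      using Cons by (simp add: sum_subtractf)
    also have "(\<Sum>j\<in>J. if i = j then 1 else 0) = (if i \<in> J then 1 else (0::int))"
      using assms(3) by simp
    finally show ?case using Cons assms(2) by (auto split: if_splits)
  next
    case 3 then show ?case using Cons by (auto split: if_splits)
  }
qed simp_all

lemma half_independent_nonsymmetric:
  assumes half: "half_independent_family \<phi> I b" and J: "J \<subseteq> I" "n \<in> I" "n \<notin> J" "finite J"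
    and x: "x \<in> span (b ` J)" and ts: "\<not> symmetric_monomial ts"
  shows "\<phi> (word2 x (b n) ts) = 0"
proof -
  have "\<phi> (word2 x (b n) ts) = \<phi> 0"
  proof (rule span_functional_eq[where f = "\<lambda>x. x" and g = "\<lambda>_. 0", OF _ word2_span[OF x]])
    fix s assume "s \<in> {prod_list (map b is) |is. list_all2 (\<lambda>t i. if t then i = n else i \<in> J) ts is}"
    then obtain "is" where s: "s = prod_list (map b is)"
      and l: "list_all2 (\<lambda>t i. if t then i = n else i \<in> J) ts is" by auto
    note exp = parity_balance_expansion[OF l J(3,4)]
    have "\<not> symmetric_monomial is"
    proof
      assume "symmetric_monomial is"
      then have "parity_balance True ts = 0" "parity_balance False ts = 0"
        using exp by (auto simp: symmetric_monomial_iff)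
      then show False using ts by (metis symmetric_monomial_iff)
    qed
    moreover have "set is \<subseteq> I" using exp(3) J by auto
    ultimately show "\<phi> s = \<phi> 0"
      using half unfolding half_independent_family_def s by (simp add: \<phi>_zero)
  qed simp_all
  then show ?thesis by (simp add: \<phi>_zero)
qed

text \<open>The pair of x and \<open>b n\<close> is half-commuting as well, so the normal form of
  symmetric words applies with the two letters of type \<open>bool\<close> and separates the
  variables with even exponents.\<close>

lemma half_independent_symmetric:
  assumes half: "half_independent_family \<phi> I b" and J: "J \<subseteq> I" "n \<in> I" "n \<notin> J" "finite J"
    and x: "x \<in> span (b ` J)" and ts: "symmetric_monomial ts"
  shows "\<phi> (word2 x (b n) ts) = \<phi> (x ^ count_list ts False) * \<phi> (b n ^ count_list ts True)"
proof -
  define g where "g t = (if t then b n else x)" for t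
  have g: "g t \<in> span (b ` I)" for t
    using x J span_mono[of "b ` J" "b ` I"] by (auto simp: g_def intro: span_base)
  have comm: "half_commuting UNIV g"
    using half half_commuting_span[of I b] g by (auto simp: half_commuting_def[of UNIV] half_independent_family_def)
  have even: "even (count_list ts t)" for t
    using ts by (simp add: symmetric_monomial_iff flip: even_parity_balance)
  have "word2 x (b n) ts = prod_list (map (\<lambda>t. (g t ^ 2) ^ (count_list ts t div 2)) [False, True])"
    unfolding word2_def g_def[symmetric] using ts
    by (intro half_commuting_symmetric_word[OF comm]) auto
  also have "\<dots> = x ^ count_list ts False * b n ^ count_list ts True"
    using even by (simp add: g_def flip: power_mult)
  finally have word: "word2 x (b n) ts = x ^ count_list ts False * b n ^ count_list ts True" .
  have "b ` J \<subseteq> span (words b J)" using span_words_var by auto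
  then have "span (b ` J) \<subseteq> span (words b J)" by (rule span_minimal) simp
  then have "x ^ count_list ts False \<in> span (words b J)" using x by (intro span_words_power) auto
  then show ?thesis
    unfolding word by (rule half_independent_mult_power[OF half J(1-3) _ even])
qed

end

section \<open>Convergence of moments\<close>

text \<open>The number of ways to place two letters in a word of length n + 2.\<close>

lemma weighted_sum_linear: "(\<Sum>j\<le>n. real (n + 1 - j)) = real (n + 1) * real (n + 2) / 2"
proof -
  have "(\<Sum>j\<le>n. real (n + 1 - j)) = (\<Sum>j\<le>n. real (j + 1))"
    by (rule sum.reindex_bij_witness[where i = "\<lambda>j. n - j" and j = "\<lambda>j. n - j"]) auto
  also have "\<dots> = real (n + 1) * real (n + 2) / 2"
    by (induction n) (simp_all add: field_simps)
  finally show ?thesis .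
qed

text \<open>The sum of the first r + 1 odd numbers; it counts the ways to place two letters at
  positions of opposite parity in a word of length 2 r + 2.\<close>

lemma weighted_sum_even: "(\<Sum>j\<le>2 * r. if even j then real (2 * r + 1 - j) else 0) = real (r + 1) ^ 2"
proof (induction r)
  case (Suc r)
  define h where "h n j = (if even j then real (n + 1 - j) else 0)" for n j :: nat
  have "(\<Sum>j\<le>2 * Suc r. h (2 * Suc r) j) = h (2 * r + 2) 0 + h (2 * r + 2) 1 + (\<Sum>j\<le>2 * r. h (2 * r + 2) (j + 2))"
    by (simp add: sum.atMost_Suc_shift del: sum.atMost_Suc)
  also have "(\<Sum>j\<le>2 * r. h (2 * r + 2) (j + 2)) = (\<Sum>j\<le>2 * r. h (2 * r) j)"
    by (intro sum.cong) (auto simp: h_def)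
  also have "\<dots> = real (r + 1) ^ 2" using Suc by (simp add: h_def)
  finally have "(\<Sum>j\<le>2 * Suc r. h (2 * Suc r) j) = real (Suc r + 1) ^ 2"
    by (simp add: h_def power2_eq_square algebra_simps)
  then show ?case by (simp only: h_def)
qed simp

lemma count_list_bool: "count_list ts False + count_list ts True = length ts"
  by (induction ts) auto

locale standardized_sequence = tracial_nc_prob_space smul star \<phi>
  for smul :: "complex \<Rightarrow> 'a::ring_1 \<Rightarrow> 'a" and star :: "'a \<Rightarrow> 'a" and \<phi> :: "'a \<Rightarrow> complex" +
  fixes b :: "nat \<Rightarrow> 'a"
  assumes mean: "i \<ge> 1 \<Longrightarrow> \<phi> (b i) = 0"
    and variance: "i \<ge> 1 \<Longrightarrow> \<phi> (b i ^ 2) = 1"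
    and moments_bounded: "bdd_above ((\<lambda>i. cmod (\<phi> (b i ^ m))) ` {1..})"
begin

definition partial_sum :: "nat \<Rightarrow> 'a" where
  "partial_sum m = (\<Sum>i=1..m. b i)"

definition normalized_moment :: "nat \<Rightarrow> nat \<Rightarrow> complex" where
  "normalized_moment k m = \<phi> (partial_sum m ^ k) / of_real (sqrt (real m) ^ k)"

lemma normalized_moment_eq:
  "normalized_moment = (\<lambda>k m. \<phi> (partial_sum m ^ k) / of_real (sqrt (real m) ^ k))"
  by (simp add: normalized_moment_def fun_eq_iff)

lemma partial_sum_Suc: "partial_sum (Suc m) = partial_sum m + b (Suc m)"
  by (simp add: partial_sum_def)

lemma partial_sum_mean: "\<phi> (partial_sum m) = 0"
  by (simp add: partial_sum_def \<phi>_sum mean)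

lemma partial_sum_span_words: "partial_sum m \<in> span (words b {1..m})"
  unfolding partial_sum_def by (rule span_words_sum_vars) simp

lemma moment_eq_normalized:
  "m \<ge> 1 \<Longrightarrow> cmod (\<phi> (partial_sum m ^ k)) = cmod (normalized_moment k m) * sqrt (real m) ^ k"
  by (simp add: normalized_moment_def norm_divide norm_power)

lemma uniform_moment_bound:
  obtains B where "B \<ge> 0" "\<And>i j. i \<ge> 1 \<Longrightarrow> j \<le> k \<Longrightarrow> cmod (\<phi> (b i ^ j)) \<le> B"
proof -
  obtain B where B: "\<And>m i. i \<ge> 1 \<Longrightarrow> cmod (\<phi> (b i ^ m)) \<le> B m"
    using moments_bounded unfolding bdd_above_def by (metis atLeast_iff imageI)
  show thesis
  proof
    show "0 \<le> (\<Sum>j\<le>k. \<bar>B j\<bar>)" by (rule sum_nonneg) simp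
    fix i j :: nat assume "i \<ge> 1" "j \<le> k"
    then have "cmod (\<phi> (b i ^ j)) \<le> \<bar>B j\<bar>" using B[of i j] by simp
    also have "\<dots> \<le> (\<Sum>j\<le>k. \<bar>B j\<bar>)" using \<open>j \<le> k\<close> by (intro member_le_sum) auto
    finally show "cmod (\<phi> (b i ^ j)) \<le> (\<Sum>j\<le>k. \<bar>B j\<bar>)" .
  qed
qed

text \<open>Serves the two notions of independence for which a two-letter word vanishes or
  factorizes. The constant is \<open>K\<close> times a common bound on the moments of the
  \<open>b i\<close>.\<close>

lemma word_moments_product_bound:
  assumes "\<And>m ts. \<phi> (word2 (partial_sum m) (b (Suc m)) ts) = 0 \<or> \<phi> (word2 (partial_sum m) (b (Suc m)) ts) =
    \<phi> (partial_sum m ^ count_list ts False) * \<phi> (b (Suc m) ^ count_list ts True)"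
  shows "\<exists>C. \<forall>m\<ge>1. (\<forall>j\<le>p. cmod (normalized_moment j m) \<le> K) \<longrightarrow>
    (\<forall>ts. length ts = k \<longrightarrow> count_list ts False \<le> p \<longrightarrow>
      cmod (\<phi> (word2 (partial_sum m) (b (Suc m)) ts)) \<le> C * sqrt (real m) ^ count_list ts False)"
proof -
  obtain B where B: "B \<ge> 0" "\<And>i j. i \<ge> 1 \<Longrightarrow> j \<le> k \<Longrightarrow> cmod (\<phi> (b i ^ j)) \<le> B"
    using uniform_moment_bound by blast
  have "cmod (\<phi> (word2 (partial_sum m) (b (Suc m)) ts)) \<le> K * B * sqrt (real m) ^ count_list ts False"
    if m: "m \<ge> 1" and K: "\<forall>j\<le>p. cmod (normalized_moment j m) \<le> K"
      and ts: "length ts = k" "count_list ts False \<le> p" for m ts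
  proof -
    have "K \<ge> 0" using K norm_ge_zero order_trans by blast
    have "count_list ts True \<le> k" using count_list_bool[of ts] ts by simp
    then have "cmod (\<phi> (b (Suc m) ^ count_list ts True)) \<le> B" by (intro B(2)) auto
    moreover have "cmod (\<phi> (partial_sum m ^ count_list ts False)) \<le> K * sqrt (real m) ^ count_list ts False"
      unfolding moment_eq_normalized[OF m] using K ts by (intro mult_right_mono) auto
    ultimately have "cmod (\<phi> (partial_sum m ^ count_list ts False)) * cmod (\<phi> (b (Suc m) ^ count_list ts True))
        \<le> (K * sqrt (real m) ^ count_list ts False) * B"
      using \<open>K \<ge> 0\<close> by (intro mult_mono) auto
    then show ?thesis
      using assms[of m ts] \<open>K \<ge> 0\<close> B(1) by (auto simp: norm_mult mult_ac)
  qed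
  then show ?thesis by blast
qed

lemma free_moments_limit:
  fixes \<mu> :: "nat \<Rightarrow> real"
  assumes free: "free_family smul \<phi> {1..} b"
    and \<mu>: "\<mu> 0 = 1" "\<mu> 1 = 0"
      "\<And>n. real (n + 2) / 2 * \<mu> (n + 2) = (\<Sum>j\<le>n. real (n + 1 - j) * (\<mu> (n - j) * \<mu> j))"
  shows "normalized_moment k \<longlonglongrightarrow> of_real (\<mu> k)"
proof -
  \<comment> \<open>The scalar is kept free: c = 1 serves the identities and c = 1 / sqrt m the
    bound.\<close>
  have pair: "free_family smul \<phi> UNIV (\<lambda>t. if t then b (Suc m) else smul c (partial_sum m))" for m c
    by (rule free_family_blocks[OF free, where J = "\<lambda>t. if t then {Suc m} else {1..m}"])
      (auto simp del: One_nat_def split: if_splits intro: span_words_var span_scale partial_sum_span_words)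
  have free_pair: "\<phi> (poly_word (\<lambda>t. if t then b (Suc m) else partial_sum m) tps) = 0"
    if "alternating (\<lambda>t. if t then b (Suc m) else partial_sum m) UNIV tps" "tps \<noteq> []" for m tps
    using pair[of m 1, unfolded scale_one free_family_iff] that by blast
  \<comment> \<open>Write x^p = A + \<alpha> and x^j = J + \<beta> with A and J centered. The word A
    y J y is alternating; in A y y, and in y J y after a cyclic shift, y^2 is centered to y^2 - 1.
    All these vanish, and only \<alpha> \<beta> times the variance of y survives.\<close>
  have two_centered: "\<phi> (partial_sum m ^ p * b (Suc m) * (partial_sum m ^ j * b (Suc m))) =
      \<phi> (partial_sum m ^ p) * \<phi> (partial_sum m ^ j)"
    and one_centered: "\<phi> (partial_sum m ^ p * b (Suc m)) = 0" for m p j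
  proof -
    let ?x = "partial_sum m" and ?y = "b (Suc m)"
    define pA where "pA = centered (monom 1 p) ?x"
    define pJ where "pJ = centered (monom 1 j) ?x"
    define pY where "pY = centered (monom 1 2) ?y"
    define A where "A = alg_poly smul pA ?x"
    define J where "J = alg_poly smul pJ ?x"
    define \<alpha> where "\<alpha> = \<phi> (?x ^ p)"
    define \<beta> where "\<beta> = \<phi> (?x ^ j)"
    define pB where "pB = monom (1 :: complex) (1 :: nat)"
    have y: "alg_poly smul pB ?y = ?y" by (simp add: pB_def alg_poly_monom)
    have Y: "alg_poly smul pY ?y = ?y ^ 2 - smul 1 1"
      by (simp add: pY_def centered_def alg_poly_diff_const alg_poly_monom variance)
    have A: "?x ^ p = A + smul \<alpha> 1" and J: "?x ^ j = J + smul \<beta> 1"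
      by (simp_all add: A_def J_def pA_def pJ_def \<alpha>_def \<beta>_def centered_def alg_poly_diff_const alg_poly_monom)
    have \<phi>A: "\<phi> A = 0" and \<phi>J: "\<phi> J = 0"
      unfolding A_def J_def pA_def pJ_def by (rule \<phi>_centered)+
    have centered_y: "\<phi> (alg_poly smul pB ?y) = 0" "\<phi> (alg_poly smul pY ?y) = 0"
    proof -
      show "\<phi> (alg_poly smul pB ?y) = 0" by (simp only: y mean)
      show "\<phi> (alg_poly smul pY ?y) = 0" by (simp only: pY_def \<phi>_centered)
    qed
    have Ay: "\<phi> (A * ?y) = 0"
      using free_pair[of m "[(False, pA), (True, pB)]"] \<phi>A centered_y
      by (simp add: alternating_def A_def y)
    have AyJy: "\<phi> (A * ?y * J * ?y) = 0"
      using free_pair[of m "[(False, pA), (True, pB), (False, pJ), (True, pB)]"] \<phi>A \<phi>J centered_y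
      by (simp add: alternating_def A_def J_def y mult.assoc)
    have "\<phi> (A * (?y ^ 2 - smul 1 1)) = 0"
      using free_pair[of m "[(False, pA), (True, pY)]"] \<phi>A centered_y
      by (simp add: alternating_def A_def Y)
    then have Ayy: "\<phi> (A * (?y * ?y)) = 0"
      using \<phi>A by (simp add: right_diff_distrib \<phi>_diff power2_eq_square)
    have "\<phi> (J * (?y ^ 2 - smul 1 1)) = 0"
      using free_pair[of m "[(False, pJ), (True, pY)]"] \<phi>J centered_y
      by (simp add: alternating_def J_def Y)
    then have "\<phi> (J * (?y * ?y)) = 0"
      using \<phi>J by (simp add: right_diff_distrib \<phi>_diff power2_eq_square)
    then have yJy: "\<phi> (?y * (J * ?y)) = 0"
      using tracial[of "?y" "J * ?y"] by (simp add: mult.assoc)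
    have yy: "\<phi> (?y * ?y) = 1" using variance[of "Suc m"] by (simp add: power2_eq_square)
    show "\<phi> (?x ^ p * ?y) = 0"
      unfolding A by (simp add: distrib_right scale_mult_left \<phi>_add \<phi>_scale Ay mean)
    show "\<phi> (?x ^ p * ?y * (?x ^ j * ?y)) = \<phi> (?x ^ p) * \<phi> (?x ^ j)"
      unfolding \<alpha>_def[symmetric] \<beta>_def[symmetric] unfolding A J
      using AyJy Ayy yJy yy
      by (simp add: distrib_right distrib_left scale_mult_left scale_mult_right \<phi>_add \<phi>_scale mult.assoc)
  qed
  show ?thesis
  proof (rule moments_limit_of_increments[where F = normalized_moment and a = partial_sum and c = "\<lambda>m. b (Suc m)" and \<theta> = "\<lambda>p j. \<mu> p * \<mu> j"
        and t = "\<lambda>m p j. \<phi> (partial_sum m ^ p) * \<phi> (partial_sum m ^ j)",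
        OF normalized_moment_eq partial_sum_Suc partial_sum_mean])
    \<comment> \<open>Traciality moves the trailing power to the front.\<close>
    show "\<phi> (partial_sum m ^ i * b (Suc m) * partial_sum m ^ l) = 0" for m i l
      using tracial[of "partial_sum m ^ i * b (Suc m)" "partial_sum m ^ l"] one_centered[of m "l + i"]
      by (simp add: power_add mult.assoc)
    show "\<phi> (partial_sum m ^ i * b (Suc m) * partial_sum m ^ j * b (Suc m) * partial_sum m ^ l) =
      \<phi> (partial_sum m ^ (i + l)) * \<phi> (partial_sum m ^ j)" for m i j l
      using tracial[of "partial_sum m ^ i * b (Suc m) * partial_sum m ^ j * b (Suc m)" "partial_sum m ^ l"]
        two_centered[of m "l + i" j]
      by (simp add: power_add mult.assoc add.commute[of i l])
    show "(\<lambda>m. \<phi> (partial_sum m ^ p) * \<phi> (partial_sum m ^ j) / of_real (sqrt (real m) ^ (p + j)))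
        \<longlonglongrightarrow> of_real (\<mu> p * \<mu> j)"
      if "\<And>r. r \<le> p + j \<Longrightarrow> normalized_moment r \<longlonglongrightarrow> of_real (\<mu> r)" for p j
      using tendsto_mult[OF that[of p] that[of j]] by (simp add: normalized_moment_def power_add)
    show "\<exists>C. \<forall>m\<ge>1. (\<forall>j\<le>p. cmod (normalized_moment j m) \<le> K) \<longrightarrow>
      (\<forall>ts. length ts = k \<longrightarrow> count_list ts False \<le> p \<longrightarrow>
        cmod (\<phi> (word2 (partial_sum m) (b (Suc m)) ts)) \<le> C * sqrt (real m) ^ count_list ts False)" for k p K
    proof -
      obtain B where B: "B \<ge> 0" "\<And>i j. i \<ge> 1 \<Longrightarrow> j \<le> k \<Longrightarrow> cmod (\<phi> (b i ^ j)) \<le> B"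
        using uniform_moment_bound by blast
      define C where "C = (1 + max B K) ^ (k * k)"
      have "cmod (\<phi> (word2 (partial_sum m) (b (Suc m)) ts)) \<le> C * sqrt (real m) ^ count_list ts False"
        if m: "m \<ge> 1" and K: "\<forall>j\<le>p. cmod (normalized_moment j m) \<le> K"
          and ts: "length ts = k" "count_list ts False \<le> p" for m ts
      proof -
        \<comment> \<open>The bound for free words is not homogeneous, so it is applied to the
          partial sum divided by sqrt m, whose moments up to order p are at most \<open>K\<close>;
          scaling back produces the power of sqrt m.\<close>
        define s where "s = sqrt (real m)"
        have s: "s > 0" using m by (simp add: s_def)
        define x where "x = smul (of_real (1 / s)) (partial_sum m)"
        have "partial_sum m = smul (of_real s) x" using s by (simp add: x_def)
        then have "word2 (partial_sum m) (b (Suc m)) ts =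
            smul (of_real s ^ count_list ts False) (word2 x (b (Suc m)) ts)"
          by (simp add: word2_scale)
        then have "cmod (\<phi> (word2 (partial_sum m) (b (Suc m)) ts)) =
            s ^ count_list ts False * cmod (\<phi> (word2 x (b (Suc m)) ts))"
          using s by (simp add: \<phi>_scale norm_mult norm_power)
        also have "cmod (\<phi> (word2 x (b (Suc m)) ts)) \<le> (1 + max B K) ^ (length ts * length ts)"
        proof (rule free_word2_bound)
          show "free_family smul \<phi> UNIV (\<lambda>t. if t then b (Suc m) else x)"
            unfolding x_def by (rule pair)
          show "cmod (\<phi> (x ^ j)) \<le> max B K" if "j \<le> count_list ts False" for j
          proof -
            have "\<phi> (x ^ j) = normalized_moment j m"
              by (simp add: x_def scale_power \<phi>_scale normalized_moment_def s_def power_divide)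
            then show ?thesis using K ts that by (simp add: le_max_iff_disj)
          qed
          show "cmod (\<phi> (b (Suc m) ^ j)) \<le> max B K" if "j \<le> count_list ts True" for j
            using B(2)[of "Suc m" j] that count_list_bool[of ts] ts by simp
        qed (use B in simp)
        finally show ?thesis using s by (simp add: C_def ts s_def mult.commute)
      qed
      then show ?thesis by blast
    qed
  qed (rule \<mu>)+
qed

text \<open>The places of the two letters \<open>b (Suc m)\<close> do not affect the value, so all
  (n + 1) (n + 2) / 2 pairs of places contribute the moment of order n.\<close>

lemma independent_moments_limit:
  fixes \<mu> :: "nat \<Rightarrow> real"
  assumes ind: "independent_family \<phi> {1..} b"
    and \<mu>: "\<mu> 0 = 1" "\<mu> 1 = 0" "\<And>n. \<mu> (n + 2) = real (n + 1) * \<mu> n"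
  shows "normalized_moment k \<longlonglongrightarrow> of_real (\<mu> k)"
proof -
  have comm: "partial_sum m * b (Suc m) = b (Suc m) * partial_sum m" for m
    using ind unfolding partial_sum_def sum_distrib_left sum_distrib_right independent_family_def
    by (intro sum.cong) auto
  have word: "\<phi> (word2 (partial_sum m) (b (Suc m)) ts) =
      \<phi> (partial_sum m ^ count_list ts False) * \<phi> (b (Suc m) ^ count_list ts True)" for m ts
    unfolding word2_commuting[OF comm]
    by (rule independent_mult_power[OF ind, where J = "{1..m}"])
      (auto simp del: One_nat_def intro: span_words_power partial_sum_span_words)
  show ?thesis
  proof (rule moments_limit_of_increments[where F = normalized_moment and a = partial_sum and c = "\<lambda>m. b (Suc m)" and \<theta> = "\<lambda>p j. \<mu> (p + j)"
        and t = "\<lambda>m p j. \<phi> (partial_sum m ^ (p + j))", OF normalized_moment_eq partial_sum_Suc partial_sum_mean])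
    show "\<phi> (partial_sum m ^ i * b (Suc m) * partial_sum m ^ l) = 0" for m i l
      using word[of m "replicate i False @ [True] @ replicate l False"]
      by (simp add: count_list_replicate mult.assoc mean)
    show "\<phi> (partial_sum m ^ i * b (Suc m) * partial_sum m ^ j * b (Suc m) * partial_sum m ^ l) =
      \<phi> (partial_sum m ^ (i + l + j))" for m i j l
      using word[of m "replicate i False @ [True] @ replicate j False @ [True] @ replicate l False"]
        variance[of "Suc m"]
      by (simp add: count_list_replicate mult.assoc numeral_2_eq_2 ac_simps)
    show "(\<lambda>m. \<phi> (partial_sum m ^ (p + j)) / of_real (sqrt (real m) ^ (p + j))) \<longlonglongrightarrow> of_real (\<mu> (p + j))"
      if "\<And>r. r \<le> p + j \<Longrightarrow> normalized_moment r \<longlonglongrightarrow> of_real (\<mu> r)" for p j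
      using that[of "p + j"] by (simp add: normalized_moment_def[abs_def])
    show "real (n + 2) / 2 * \<mu> (n + 2) = (\<Sum>j\<le>n. real (n + 1 - j) * \<mu> (n - j + j))" for n
    proof -
      have "(\<Sum>j\<le>n. real (n + 1 - j) * \<mu> (n - j + j)) = (\<Sum>j\<le>n. real (n + 1 - j)) * \<mu> n"
        by (simp add: sum_distrib_right)
      then show ?thesis unfolding weighted_sum_linear \<mu>(3) by simp
    qed
    show "\<exists>C. \<forall>m\<ge>1. (\<forall>j\<le>p. cmod (normalized_moment j m) \<le> K) \<longrightarrow>
      (\<forall>ts. length ts = k \<longrightarrow> count_list ts False \<le> p \<longrightarrow>
        cmod (\<phi> (word2 (partial_sum m) (b (Suc m)) ts)) \<le> C * sqrt (real m) ^ count_list ts False)" for k p K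
      using word by (intro word_moments_product_bound) blast
  qed (rule \<mu>)+
qed

text \<open>A word with two letters \<open>b (Suc m)\<close> is symmetric only if these stand at
  positions of opposite parity, that is for even j. For n = 2 r this leaves (r + 1)^2 words, and for
  odd n all moments involved vanish.\<close>

lemma half_independent_moments_limit:
  fixes \<mu> :: "nat \<Rightarrow> real"
  assumes half: "half_independent_family \<phi> {1..} b"
    and \<mu>: "\<mu> 0 = 1" "\<mu> 1 = 0" "\<And>n. \<mu> (n + 2) = real (n + 2) / 2 * \<mu> n"
  shows "normalized_moment k \<longlonglongrightarrow> of_real (\<mu> k)"
proof -
  have x: "partial_sum m \<in> span (b ` {1..m})" for m
    unfolding partial_sum_def by (intro span_sum span_base) auto
  have nonsym: "\<phi> (word2 (partial_sum m) (b (Suc m)) ts) = 0" if "\<not> symmetric_monomial ts" for m ts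
    by (rule half_independent_nonsymmetric[OF half _ _ _ _ x that]) auto
  have sym: "\<phi> (word2 (partial_sum m) (b (Suc m)) ts) =
      \<phi> (partial_sum m ^ count_list ts False) * \<phi> (b (Suc m) ^ count_list ts True)"
    if "symmetric_monomial ts" for m ts
    by (rule half_independent_symmetric[OF half _ _ _ _ x that]) auto
  have odd_moment: "\<phi> (partial_sum m ^ k) = 0" if "odd k" for m k
  proof -
    have "parity_balance False (replicate k False) \<noteq> 0"
      using that by (simp add: parity_balance_replicate)
    then have "\<not> symmetric_monomial (replicate k False)" unfolding symmetric_monomial_iff by blast
    from nonsym[OF this, of m] show ?thesis by simp
  qed
  have odd_\<mu>: "\<mu> n = 0" if "odd n" for n
    using that
  proof (induction n rule: induct_nat_012)
    case (ge2 n)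
    then show ?case using \<mu>(3)[of n] by simp
  qed (use \<mu> in auto)
  show ?thesis
  proof (rule moments_limit_of_increments[where F = normalized_moment and a = partial_sum and c = "\<lambda>m. b (Suc m)"
        and \<theta> = "\<lambda>p j. if even j then \<mu> (p + j) else 0"
        and t = "\<lambda>m p j. if even j then \<phi> (partial_sum m ^ (p + j)) else 0",
        OF normalized_moment_eq partial_sum_Suc partial_sum_mean])
    show "\<phi> (partial_sum m ^ i * b (Suc m) * partial_sum m ^ l) = 0" for m i l
    proof -
      let ?ts = "replicate i False @ [True] @ replicate l False"
      have "parity_balance True ?ts \<noteq> 0"
        by (simp add: parity_balance_append parity_balance_replicate)
      then have "\<not> symmetric_monomial ?ts" unfolding symmetric_monomial_iff by blast
      from nonsym[OF this, of m] show ?thesis by (simp add: mult.assoc)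
    qed
    show "\<phi> (partial_sum m ^ i * b (Suc m) * partial_sum m ^ j * b (Suc m) * partial_sum m ^ l) =
      (if even j then \<phi> (partial_sum m ^ (i + l + j)) else 0)" for m i j l
    proof -
      let ?ts = "replicate i False @ [True] @ replicate j False @ [True] @ replicate l False"
      have word: "\<phi> (partial_sum m ^ i * b (Suc m) * partial_sum m ^ j * b (Suc m) * partial_sum m ^ l) =
          \<phi> (word2 (partial_sum m) (b (Suc m)) ?ts)"
        by (simp add: mult.assoc)
      have bal: "parity_balance True ?ts = (- 1) ^ i * (1 - (- 1) ^ j)"
        by (simp add: parity_balance_append parity_balance_replicate)
      have "parity_balance False ts = (if even (length ts) then 0 else 1) - parity_balance True ts" for ts
        using parity_balance_bool[of ts] by linarith
      moreover have "even (length ?ts) = even (i + j + l)" by auto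
      ultimately have bal': "parity_balance False ?ts = (if even (i + j + l) then 0 else 1) - parity_balance True ?ts"
        by (simp only:)
      show ?thesis
      proof (cases "even j \<and> even (i + j + l)")
        case True
        then have "parity_balance True ?ts = 0" unfolding bal by simp
        moreover from this have "parity_balance False ?ts = 0" unfolding bal' using True by auto
        ultimately have "symmetric_monomial ?ts" unfolding symmetric_monomial_iff by (metis (full_types))
        from sym[OF this, of m] show ?thesis
          unfolding word using True variance[of "Suc m"]
          by (simp add: count_list_replicate numeral_2_eq_2 ac_simps)
      next
        case False
        \<comment> \<open>For odd j the letter \<open>True\<close> is unbalanced. For even j the
          length is odd and \<open>False\<close> is unbalanced; the claimed value is then an odd
          moment, which vanishes too.\<close>
        have "parity_balance True ?ts \<noteq> 0 \<or> parity_balance False ?ts \<noteq> 0"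
          using False unfolding bal' bal by (cases "even j") auto
        then have "\<not> symmetric_monomial ?ts" unfolding symmetric_monomial_iff by blast
        from nonsym[OF this, of m] show ?thesis
          unfolding word using False odd_moment[of "i + l + j" m] by auto
      qed
    qed
    show "(\<lambda>m. (if even j then \<phi> (partial_sum m ^ (p + j)) else 0) / of_real (sqrt (real m) ^ (p + j)))
        \<longlonglongrightarrow> of_real (if even j then \<mu> (p + j) else 0)"
      if "\<And>r. r \<le> p + j \<Longrightarrow> normalized_moment r \<longlonglongrightarrow> of_real (\<mu> r)" for p j
      using that[of "p + j"] by (simp add: normalized_moment_def[abs_def])
    show "real (n + 2) / 2 * \<mu> (n + 2) = (\<Sum>j\<le>n. real (n + 1 - j) * (if even j then \<mu> (n - j + j) else 0))" for n
    proof (cases "even n")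
      case True
      then obtain r where r: "n = 2 * r" by auto
      have "(\<Sum>j\<le>n. real (n + 1 - j) * (if even j then \<mu> (n - j + j) else 0)) =
          (\<Sum>j\<le>2 * r. if even j then real (2 * r + 1 - j) else 0) * \<mu> n"
        unfolding sum_distrib_right r by (intro sum.cong) auto
      also have "\<dots> = real (r + 1) ^ 2 * \<mu> n" by (simp only: weighted_sum_even)
      also have "\<dots> = real (n + 2) / 2 * \<mu> (n + 2)"
      proof -
        have "real (n + 2) / 2 = real (r + 1)" by (simp add: r)
        then show ?thesis unfolding \<mu>(3) by (simp only: power2_eq_square mult.assoc)
      qed
      finally show ?thesis by simp
    next
      case False
      then have "(\<Sum>j\<le>n. real (n + 1 - j) * (if even j then \<mu> (n - j + j) else 0)) = 0"
        by (intro sum.neutral) (auto simp: odd_\<mu>)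
      moreover have "\<mu> (n + 2) = 0" using False by (intro odd_\<mu>) simp
      ultimately show ?thesis by (simp only: mult_zero_right)
    qed
    show "\<exists>C. \<forall>m\<ge>1. (\<forall>j\<le>p. cmod (normalized_moment j m) \<le> K) \<longrightarrow>
      (\<forall>ts. length ts = k \<longrightarrow> count_list ts False \<le> p \<longrightarrow>
        cmod (\<phi> (word2 (partial_sum m) (b (Suc m)) ts)) \<le> C * sqrt (real m) ^ count_list ts False)" for k p K
      using sym nonsym by (intro word_moments_product_bound) blast
  qed (rule \<mu>)+
qed

end

section \<open>The three limit laws at the random index\<close>

theorem corollary6p2:
  fixes scaleA :: "complex \<Rightarrow> 'a::ring_1 \<Rightarrow> 'a" and starA :: "'a \<Rightarrow> 'a" and \<phi> :: "'a \<Rightarrow> complex"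
    and scaleC :: "complex \<Rightarrow> 'c::ring_1 \<Rightarrow> 'c" and starC :: "'c \<Rightarrow> 'c" and \<tau> :: "'c \<Rightarrow> complex"
    and M :: "'w measure"
    and b :: "nat \<Rightarrow> 'a" and a :: "nat \<Rightarrow> 'a"
    and w :: "nat \<Rightarrow> nat" and N :: "nat \<Rightarrow> 'w \<Rightarrow> nat"
    and x :: "nat \<Rightarrow> 'w \<Rightarrow> 'a"
  assumes "tracial_nc_prob_space scaleA starA \<phi>"
    and "nc_prob_space scaleC starC \<tau>"
    and "prob_space M"
    and "\<And>i. i \<ge> 1 \<Longrightarrow> self_adjoint starA (b i)"
    and "\<And>i. i \<ge> 1 \<Longrightarrow> \<phi> (b i) = 0"
    and "\<And>i. i \<ge> 1 \<Longrightarrow> \<phi> (b i ^ 2) = 1"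
    and "\<And>m. bdd_above ((\<lambda>i. cmod (\<phi> (b i ^ m))) ` {1..})"
    and "\<And>n. a n = (\<Sum>i=1..n. b i)"
    and "\<And>n. n \<ge> 1 \<Longrightarrow> w n > 0"
    and "mono_on {1..} w"
    and "filterlim w at_top sequentially"
    and "\<And>n. n \<ge> 1 \<Longrightarrow> N n \<in> measurable M (count_space UNIV)"
    and "\<And>n m. n \<ge> 1 \<Longrightarrow> integrable M (\<lambda>\<omega>. real (N n \<omega>) ^ m)"
    and "tendsto_in_prob_const M (\<lambda>n \<omega>. real (N n \<omega>) / real (w n)) 1"
    and "\<And>m. uniformly_integrable M {1..} (\<lambda>n \<omega>. (real (N n \<omega>) / real (w n)) ^ m)"
    and "\<And>n. x n = rand_scale scaleA (complex_of_real (1 / sqrt (real (w n)))) (rand_indexed a (N n))"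
  shows
    "(free_family scaleA \<phi> {1..} b \<longrightarrow>
        (\<forall>s. has_law starC \<tau> s semicircle_law \<longrightarrow>
           star_converges (rand_domain M \<phi>) (rand_state M \<phi>) x \<tau> s)) \<and>
     (independent_family \<phi> {1..} b \<longrightarrow>
        (\<forall>z. has_law starC \<tau> z std_normal_distribution \<longrightarrow>
           star_converges (rand_domain M \<phi>) (rand_state M \<phi>) x \<tau> z)) \<and>
     (half_independent_family \<phi> {1..} b \<longrightarrow>
        (\<forall>r. has_law starC \<tau> r symmetrized_rayleigh_law \<longrightarrow>
           star_converges (rand_domain M \<phi>) (rand_state M \<phi>) x \<tau> r))"
proof -
  interpret standardized_sequence scaleA starA \<phi> b
    using assms(1,5-7) by (simp add: standardized_sequence_def standardized_sequence_axioms_def)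
  have a: "a = partial_sum"
    using assms(8) by (simp add: fun_eq_iff partial_sum_def)
  have power: "\<phi> ((x n ^ k) \<omega>) = \<phi> (partial_sum (N n \<omega>) ^ k) / of_real (sqrt (real (w n)) ^ k)" for n k \<omega>
    by (simp add: power_fun_apply assms(16) rand_scale_def rand_indexed_def a scale_power \<phi>_scale power_divide)
  \<comment> \<open>The notion of independence enters through \<open>lim\<close> alone, so the
    passage to the random index is shared by the three cases.\<close>
  have conv: "star_converges (rand_domain M \<phi>) (rand_state M \<phi>) x \<tau> y"
    if lim: "\<And>k. normalized_moment k \<longlonglongrightarrow> of_real (\<integral>t. t ^ k \<partial>\<nu>)" and y: "has_law starC \<tau> y \<nu>" for y \<nu>
  proof -
    \<comment> \<open>The random index may take the value 0, where the empty sum has vanishing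
      powers.\<close>
    have zero: "\<phi> (partial_sum 0 ^ k) = 0" if "k > 0" for k
      using that by (simp add: partial_sum_def \<phi>_zero power_0_left)
    have "x n ^ k \<in> rand_domain M \<phi>" if "n \<ge> 1" for n k
      unfolding rand_domain_def mem_Collect_eq power
      using random_index_integrable[OF assms(3) assms(12,13)[OF that] lim[of k, unfolded normalized_moment_def[abs_def]] zero]
      by simp
    moreover have "(\<lambda>n. rand_state M \<phi> (x n ^ k)) \<longlonglongrightarrow> \<tau> (y ^ k)" for k
    proof -
      have "\<tau> (y ^ k) = of_real (\<integral>t. t ^ k \<partial>\<nu>)"
        using y by (simp add: has_law_def has_moments_def)
      then show ?thesis
        unfolding rand_state_def power
        using random_index_limit[OF assms(3,9,11,12,14,15) lim[of k, unfolded normalized_moment_def[abs_def]] zero]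
        by simp
    qed
    ultimately show ?thesis by (simp add: star_converges_def)
  qed
  \<comment> \<open>Total mass and integrability of the powers are read off from
    \<open>has_law\<close> rather than computed from the densities.\<close>
  have law: "prob_space \<nu>" "\<And>k. integrable \<nu> (\<lambda>t. t ^ k)" "(\<integral>t. t ^ 0 \<partial>\<nu>) = 1"
    if "has_law starC \<tau> y \<nu>" for y \<nu>
    using that prob_space.prob_space[of \<nu>] by (auto simp: has_law_def has_moments_def)
  show ?thesis
  proof (intro conjI impI allI)
    fix s assume free: "free_family scaleA \<phi> {1..} b" and s: "has_law starC \<tau> s semicircle_law"
    show "star_converges (rand_domain M \<phi>) (rand_state M \<phi>) x \<tau> s"
      using free_moments_limit[OF free, of "\<lambda>k. \<integral>t. t ^ k \<partial>semicircle_law"] law(1,3)[OF s]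
        semicircle_first_moment semicircle_moments[OF law(1)[OF s]]
      by (intro conv[OF _ s]) simp
  next
    fix z assume ind: "independent_family \<phi> {1..} b" and z: "has_law starC \<tau> z std_normal_distribution"
    show "star_converges (rand_domain M \<phi>) (rand_state M \<phi>) x \<tau> z"
      using independent_moments_limit[OF ind std_normal_moments] by (intro conv[OF _ z]) simp
  next
    fix r assume half: "half_independent_family \<phi> {1..} b" and r: "has_law starC \<tau> r symmetrized_rayleigh_law"
    show "star_converges (rand_domain M \<phi>) (rand_state M \<phi>) x \<tau> r"
      using half_independent_moments_limit[OF half law(3)[OF r] symmetrized_rayleigh_moments[OF law(2)[OF r]]]
      by (intro conv[OF _ r]) simp
  qed
qed

end
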